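(* Let $X$ be a non-Euclidean real normed space of finite dimension $d$, and let $(G,p)$ be a small well-positioned framework in $X$. Then $(G,p)$ is infinitesimally flexible or $|V(G)|=1$.
   Context: A normed space is Euclidean if its norm is generated by an inner product, and non-Euclidean otherwise. $\operatorname{Isom}(X)$ is the group of isometries of $X$. A framework $(G,p)$ in $X$ is a simple graph $G$ with non-empty vertex set $V(G)$ and edge set $E(G)$ together with a placement $p=(p_v)_{v\in V(G)}\in X^{V(G)}$. A framework in a $d$-dimensional normed space is small if $|V(G)|\le d+1$. $f\in X^*$ is a support functional of $x\in X$ if $\|f\|=\|x\|$ (operator norm) and $f(x)=\|x\|^2$. A non-zero $x$ is smooth if it has exactly one support functional, denoted $\varphi(x)$. $(G,p)$ is well-positioned if $p_v-p_w$ is smooth for every edge $vw\in E(G)$; then $\varphi_{v,w}:=\varphi\left(\frac{p_v-p_w}{\|p_v-p_w\|}\right)$, and the rigidity operator is the linear map $df_G(p):X^{V(G)}\to\mathbb{R}^{E(G)}$, $x\mapsto(\varphi_{v,w}(x_v-x_w))_{vw\in E(G)}$. An infinitesimal flex of $(G,p)$ is $u\in X^{V(G)}$ with $df_G(p)u=0$. The orbit of $p$ is $\mathcal{O}_p=\{(g(p_v))_v:g\in\operatorname{Isom}(X)\}$. A flex $u$ is trivial if there are continuous paths $\alpha_v:(-\delta,\delta)\to X$ ($v\in V(G)$, common $\delta>0$), differentiable at $0$, with $\alpha_v(0)=p_v$, $(\alpha_v(t))_v\in\mathcal{O}_p$ for all $t$, and $u_v=\alpha_v'(0)$ for all $v$.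 A well-positioned framework is infinitesimally rigid if every infinitesimal flex is trivial, and infinitesimally flexible otherwise. *)

theory Defs
  imports "HOL-Analysis.Analysis"
begin

definition inner_product :: "('a::real_vector \<Rightarrow> 'a \<Rightarrow> real) \<Rightarrow> bool" where
  "inner_product ip \<longleftrightarrow>
     bilinear ip \<and> (\<forall>x y. ip x y = ip y x) \<and> (\<forall>x. x \<noteq> 0 \<longrightarrow> ip x x > 0)"

definition euclidean_norm :: "('a::real_vector \<Rightarrow> real) \<Rightarrow> bool" where
  "euclidean_norm N \<longleftrightarrow> (\<exists>ip. inner_product ip \<and> (\<forall>x. N x = sqrt (ip x x)))"

definition isometry_group :: "('a::metric_space \<Rightarrow> 'a) set" where
  "isometry_group = {g. bij g \<and> (\<forall>x y. dist (g x) (g y) = dist x y)}"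

definition support_functional :: "('a::real_normed_vector \<Rightarrow>\<^sub>L real) \<Rightarrow> 'a \<Rightarrow> bool" where
  "support_functional f x \<longleftrightarrow> norm f = norm x \<and> blinfun_apply f x = (norm x)\<^sup>2"

definition smooth_point :: "'a::real_normed_vector \<Rightarrow> bool" where
  "smooth_point x \<longleftrightarrow> x \<noteq> 0 \<and> (\<exists>!f. support_functional f x)"

definition dual_map :: "'a::real_normed_vector \<Rightarrow> ('a \<Rightarrow>\<^sub>L real)" where
  "dual_map x = (THE f. support_functional f x)"

definition simple_graph :: "'v set \<Rightarrow> 'v set set \<Rightarrow> bool" where
  "simple_graph V E \<longleftrightarrow> E \<subseteq> {e. e \<subseteq> V \<and> card e = 2}"

text \<open>
  Simple graphs are given by a vertex set and a set of two-element subsets of it.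
  Elements of \<open>X\<^sup>V\<close> (placements, flexes) are total functions
  of which only the values on \<open>V\<close> matter.
\<close>

definition framework :: "'v set \<Rightarrow> 'v set set \<Rightarrow> ('v \<Rightarrow> 'a::real_normed_vector) \<Rightarrow> bool" where
  "framework V E p \<longleftrightarrow> simple_graph V E \<and> V \<noteq> {}"

definition small_framework :: "'v set \<Rightarrow> 'v set set \<Rightarrow> ('v \<Rightarrow> 'a::real_normed_vector) \<Rightarrow> bool" where
  "small_framework V E p \<longleftrightarrow>
     framework V E p \<and> finite V \<and> card V \<le> dim (UNIV :: 'a set) + 1"

definition well_positioned :: "'v set \<Rightarrow> 'v set set \<Rightarrow> ('v \<Rightarrow> 'a::real_normed_vector) \<Rightarrow> bool" where
  "well_positioned V E p \<longleftrightarrow>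
     framework V E p \<and> (\<forall>v w. {v, w} \<in> E \<longrightarrow> smooth_point (p v - p w))"

definition edge_functional :: "('v \<Rightarrow> 'a::real_normed_vector) \<Rightarrow> 'v \<Rightarrow> 'v \<Rightarrow> ('a \<Rightarrow>\<^sub>L real)" where
  "edge_functional p v w = dual_map ((p v - p w) /\<^sub>R norm (p v - p w))"

text \<open>
  Edges are unordered pairs. For a well-positioned framework the entry at an edge does not
  depend on which endpoint comes first, since swapping the endpoints changes
  the sign of both the functional and its argument (\<open>rigidity_operator_edge\<close> below).
\<close>

definition rigidity_operator ::
  "'v set set \<Rightarrow> ('v \<Rightarrow> 'a::real_normed_vector) \<Rightarrow> ('v \<Rightarrow> 'a) \<Rightarrow> ('v set \<Rightarrow> real)" where
  "rigidity_operator E p x =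
     (\<lambda>e\<in>E. THE r. \<exists>v w. e = {v, w} \<and> r = blinfun_apply (edge_functional p v w) (x v - x w))"

definition infinitesimal_flex ::
  "'v set set \<Rightarrow> ('v \<Rightarrow> 'a::real_normed_vector) \<Rightarrow> ('v \<Rightarrow> 'a) \<Rightarrow> bool" where
  "infinitesimal_flex E p u \<longleftrightarrow> rigidity_operator E p u = (\<lambda>e\<in>E. 0)"

definition orbit :: "'v set \<Rightarrow> ('v \<Rightarrow> 'a::real_normed_vector) \<Rightarrow> ('v \<Rightarrow> 'a) set" where
  "orbit V p = (\<lambda>g. \<lambda>v\<in>V. g (p v)) ` isometry_group"

definition trivial_flex ::
  "'v set \<Rightarrow> ('v \<Rightarrow> 'a::real_normed_vector) \<Rightarrow> ('v \<Rightarrow> 'a) \<Rightarrow> bool" where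
  "trivial_flex V p u \<longleftrightarrow>
     (\<exists>\<delta>>0. \<exists>\<alpha> :: 'v \<Rightarrow> real \<Rightarrow> 'a.
        (\<forall>v\<in>V. continuous_on {-\<delta><..<\<delta>} (\<alpha> v) \<and> \<alpha> v 0 = p v \<and>
                (\<alpha> v has_vector_derivative u v) (at 0)) \<and>
        (\<forall>t\<in>{-\<delta><..<\<delta>}. (\<lambda>v\<in>V. \<alpha> v t) \<in> orbit V p))"

definition infinitesimally_rigid ::
  "'v set \<Rightarrow> 'v set set \<Rightarrow> ('v \<Rightarrow> 'a::real_normed_vector) \<Rightarrow> bool" where
  "infinitesimally_rigid V E p \<longleftrightarrow>
     well_positioned V E p \<and> (\<forall>u. infinitesimal_flex E p u \<longrightarrow> trivial_flex V p u)"

definition infinitesimally_flexible ::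
  "'v set \<Rightarrow> 'v set set \<Rightarrow> ('v \<Rightarrow> 'a::real_normed_vector) \<Rightarrow> bool" where
  "infinitesimally_flexible V E p \<longleftrightarrow>
     well_positioned V E p \<and> \<not> infinitesimally_rigid V E p"

lemma support_functional_scaleR:
  assumes "c \<noteq> 0"
  shows "support_functional (c *\<^sub>R f) (c *\<^sub>R x) \<longleftrightarrow> support_functional f x"
proof -
  have "(\<bar>c\<bar> * norm x)\<^sup>2 = c * (c * (norm x)\<^sup>2)"
    by (simp only: power_mult_distrib power2_abs) (simp only: power2_eq_square mult.assoc)
  then show ?thesis
    using assms by (simp add: support_functional_def blinfun.scaleR_left blinfun.scaleR_right)
qed

lemma smooth_point_scaleR:
  assumes "c \<noteq> 0" "smooth_point x"
  shows "smooth_point (c *\<^sub>R x)" and "dual_map (c *\<^sub>R x) = c *\<^sub>R dual_map x"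
proof -
  obtain f where f: "support_functional f x" "\<And>g. support_functional g x \<Longrightarrow> g = f" and "x \<noteq> 0"
    using assms(2) by (auto simp: smooth_point_def)
  have 1: "support_functional (c *\<^sub>R f) (c *\<^sub>R x)"
    using f(1) assms(1) by (simp add: support_functional_scaleR)
  have 2: "g = c *\<^sub>R f" if "support_functional g (c *\<^sub>R x)" for g
  proof -
    have "support_functional (c *\<^sub>R (g /\<^sub>R c)) (c *\<^sub>R x)"
      using that assms(1) by simp
    then have "g /\<^sub>R c = f"
      using f(2) unfolding support_functional_scaleR[OF assms(1)] by blast
    then have "c *\<^sub>R (g /\<^sub>R c) = c *\<^sub>R f" by (rule arg_cong)
    then show ?thesis using assms(1) by simp
  qed
  show "smooth_point (c *\<^sub>R x)"
    unfolding smooth_point_def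
  proof
    show "c *\<^sub>R x \<noteq> 0" using \<open>x \<noteq> 0\<close> assms(1) by simp
    show "\<exists>!g. support_functional g (c *\<^sub>R x)" by (rule ex1I) (fact 1, erule 2)
  qed
  have "dual_map (c *\<^sub>R x) = c *\<^sub>R f"
    unfolding dual_map_def by (rule the_equality) (fact 1, erule 2)
  moreover have "dual_map x = f"
    unfolding dual_map_def by (rule the_equality) (fact f(1), erule f(2))
  ultimately show "dual_map (c *\<^sub>R x) = c *\<^sub>R dual_map x" by simp
qed

lemma edge_functional_swap:
  assumes "smooth_point (p v - p w)"
  shows "edge_functional p w v = - edge_functional p v w"
proof -
  have nz: "norm (p v - p w) \<noteq> 0" using assms by (auto simp: smooth_point_def)
  let ?y = "(p v - p w) /\<^sub>R norm (p v - p w)"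
  have "smooth_point ?y"
    using smooth_point_scaleR(1)[OF _ assms, of "inverse (norm (p v - p w))"] nz by simp
  moreover have "(p w - p v) /\<^sub>R norm (p w - p v) = (-1) *\<^sub>R ?y"
    by (simp add: norm_minus_commute scaleR_diff_right)
  ultimately show ?thesis
    using smooth_point_scaleR(2)[of "-1" ?y] by (simp add: edge_functional_def)
qed

lemma rigidity_operator_edge:
  assumes "well_positioned V E p" and "{v, w} \<in> E"
  shows "rigidity_operator E p x {v, w} = blinfun_apply (edge_functional p v w) (x v - x w)"
proof -
  have sm: "smooth_point (p v - p w)"
    using assms by (auto simp: well_positioned_def)
  have swap: "blinfun_apply (edge_functional p w v) (x w - x v)
      = blinfun_apply (edge_functional p v w) (x v - x w)"
    unfolding edge_functional_swap[where p = p, OF sm]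
    by (simp add: blinfun.minus_left blinfun.diff_right)
  have "(THE r. \<exists>v' w'. {v, w} = {v', w'} \<and>
          r = blinfun_apply (edge_functional p v' w') (x v' - x w'))
        = blinfun_apply (edge_functional p v w) (x v - x w)"
    by (rule the_equality) (use swap in \<open>auto simp: doubleton_eq_iff\<close>)
  then show ?thesis using assms(2) by (simp add: rigidity_operator_def)
qed

end

theory Submission
  imports Defs
begin

text \<open>
  Suppose that a small framework with at least two vertices is infinitesimally rigid. The proof
  shows that the norm is Euclidean.

  By the Mazur--Ulam theorem (\<open>isometry_linear_part\<close>), isometries of \<open>X\<close> are affine. The linear
  isometries form a compact group, so there is an inner product \<open>ip\<close> that they preserve
  (\<open>exists_invariant_inner_product\<close>). Differentiating a motion in the orbit of \<open>p\<close> therefore shows that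
  every trivial flex \<open>u\<close> is a Euclidean infinitesimal motion: it satisfies
  \<open>ip (u a - u b) (p a - p b) = 0\<close> for all vertices \<open>a\<close> and \<open>b\<close>, and it preserves the affine relations
  between the points. By rigidity this is so for all infinitesimal flexes.

  The next step is a comparison of dimensions. With \<open>n \<le> d + 1\<close> vertices there are at most
  \<open>n * (n - 1) / 2\<close> edges, so the flexes form a space of dimension at least
  \<open>d * n - n * (n - 1) / 2\<close>. The Euclidean motions of the points have at most this
  dimension. As the former space is contained in the latter, the two are equal. In particular,
  for vertices \<open>v\<close> and \<open>w\<close> with \<open>q = p w - p v \<noteq> 0\<close>, the relative velocities \<open>u w - u v\<close> of trivial
  flexes fill the whole hyperplane orthogonal to \<open>q\<close> (\<open>relative_velocities_fill_hyperplane\<close>). So the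
  orbit of \<open>q\<close> under the linear isometries has a full tangent space in the Euclidean sphere. By
  homogeneity this is true at every point of the orbit.

  A compact subset of a sphere with this property meets every line through the origin: a point of it at
  which \<open>ip y\<close> is largest is a critical point of \<open>ip y\<close> on the sphere, hence parallel to \<open>y\<close>. The norm is
  constant on the orbit, so it is a multiple of the Euclidean norm
  (\<open>euclidean_norm_if_relative_velocities_fill\<close>).
\<close>

section \<open>Finite-dimensional normed spaces\<close>

lemma compact_PiE_UNIV:
  fixes S :: "'i \<Rightarrow> 'b::topological_space set"
  assumes "\<And>i. compact (S i)"
  shows "compact (PiE UNIV S)"
proof -
  have "compactin (product_topology (\<lambda>i. euclidean) UNIV) (PiE UNIV S)"
    using assms by (simp add: compactin_PiE)
  then show ?thesis by (simp add: euclidean_product_topology)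
qed

lemma continuous_on_evaluation [continuous_intros]:
  "continuous_on S (\<lambda>f :: 'i \<Rightarrow> 'b::topological_space. f i)"
  by (rule continuous_on_subset[OF continuous_on_product_coordinates subset_UNIV])

text \<open>
  The norm is a continuous function on the compact boundary of the unit cube of coefficients, and it
  is positive there by linear independence. Its minimum gives the constant, and scaling the largest
  coefficient to one gives the general case.
\<close>

lemma coordinates_bounded_by_norm:
  fixes B :: "'a::real_normed_vector set"
  assumes "finite B" "independent B"
  shows "\<exists>\<mu>>0. \<forall>c. \<forall>e\<in>B. \<bar>c e\<bar> \<le> \<mu> * norm (\<Sum>e\<in>B. c e *\<^sub>R e)"
proof (cases "B = {}")
  case True
  then show ?thesis by (auto intro!: exI[of _ 1])
next
  case False
  define cube where "cube = PiE UNIV (\<lambda>e. if e \<in> B then {-1..1::real} else {0})"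
  define K where "K = cube \<inter> (\<Union>e\<in>B. {c. \<bar>c e\<bar> = 1})"
  define f where "f c = norm (\<Sum>e\<in>B. c e *\<^sub>R e)" for c :: "'a \<Rightarrow> real"
  have "compact cube"
    unfolding cube_def by (rule compact_PiE_UNIV) auto
  moreover have "closed {c :: 'a \<Rightarrow> real. \<bar>c e\<bar> = 1}" for e
    by (intro closed_Collect_eq continuous_intros)
  ultimately have "compact K"
    unfolding K_def using assms(1) by (intro compact_Int_closed closed_UN) auto
  moreover have "K \<noteq> {}"
  proof -
    obtain e where "e \<in> B" using False by blast
    then have "(\<lambda>x. if x = e then 1 else 0) \<in> K" by (auto simp: K_def cube_def PiE_iff)
    then show ?thesis by blast
  qed
  moreover have "continuous_on K f"
    unfolding f_def by (intro continuous_intros)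
  ultimately obtain c0 where c0: "c0 \<in> K" "\<And>c. c \<in> K \<Longrightarrow> f c0 \<le> f c"
    using continuous_attains_inf[of K f] by metis
  have pos: "f c0 > 0"
  proof -
    obtain e where "e \<in> B" "c0 e \<noteq> 0" using c0(1) by (auto simp: K_def)
    then have "(\<Sum>e\<in>B. c0 e *\<^sub>R e) \<noteq> 0"
      using assms independentD by blast
    then show ?thesis by (simp add: f_def)
  qed
  have "\<bar>c e\<bar> \<le> inverse (f c0) * f c" if "e \<in> B" for c e
  proof -
    define m where "m = Max ((\<lambda>e. \<bar>c e\<bar>) ` B)"
    have m: "\<bar>c x\<bar> \<le> m" if "x \<in> B" for x
      using assms(1) that by (simp add: m_def)
    have "m \<in> (\<lambda>e. \<bar>c e\<bar>) ` B"
      unfolding m_def by (rule Max_in) (use assms(1) False in auto)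
    then obtain e' where e': "e' \<in> B" "m = \<bar>c e'\<bar>" by blast
    show ?thesis
    proof (cases "m = 0")
      case True
      then have "c e = 0" using m[OF that] by simp
      then show ?thesis using pos by (simp add: f_def)
    next
      case False
      then have "m > 0" using e' by simp
      let ?c = "\<lambda>x. if x \<in> B then c x / m else 0"
      have "?c \<in> K"
        using m \<open>m > 0\<close> e' by (fastforce simp: K_def cube_def PiE_iff abs_le_iff field_simps)
      then have "f c0 \<le> f ?c" by (rule c0(2))
      also have "f ?c = f c / m"
      proof -
        have "(\<Sum>e\<in>B. ?c e *\<^sub>R e) = (1 / m) *\<^sub>R (\<Sum>e\<in>B. c e *\<^sub>R e)"
          unfolding scaleR_sum_right by (rule sum.cong) auto
        then show ?thesis using \<open>m > 0\<close> by (simp add: f_def)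
      qed
      finally have "m \<le> inverse (f c0) * f c"
        using pos \<open>m > 0\<close> by (simp add: field_simps)
      then show ?thesis using m[OF that] by linarith
    qed
  qed
  then show ?thesis
    using pos unfolding f_def by (intro exI[of _ "inverse (f c0)"]) (simp add: f_def)
qed

text \<open>
  A type of class \<^class>\<open>real_normed_vector\<close> carries no information about its dimension, so
  finite-dimensionality is recorded by a basis. Topological facts that are standard for
  \<^class>\<open>euclidean_space\<close> are derived from it.
\<close>

locale normed_basis =
  fixes B :: "'a::real_normed_vector set"
  assumes finite_B: "finite B" and independent_B: "independent B" and span_B: "span B = UNIV"
begin

abbreviation coord :: "'a \<Rightarrow> 'a \<Rightarrow> real" where
  "coord \<equiv> representation B"

lemma sum_coord: "(\<Sum>e\<in>B. coord x e *\<^sub>R e) = x"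
  using real_vector.sum_representation_eq[OF independent_B _ finite_B subset_refl, of x] span_B
  by simp

lemma coord_bound: "\<exists>\<mu>>0. \<forall>x. \<forall>e\<in>B. \<bar>coord x e\<bar> \<le> \<mu> * norm x"
proof -
  obtain \<mu> where "\<mu> > 0" "\<And>c e. e \<in> B \<Longrightarrow> \<bar>c e\<bar> \<le> \<mu> * norm (\<Sum>e\<in>B. c e *\<^sub>R e)"
    using coordinates_bounded_by_norm[OF finite_B independent_B] by blast
  then show ?thesis by (intro exI[of _ \<mu>]) (metis sum_coord)
qed

lemma linear_coord: "linear (\<lambda>x. coord x e)"
  using span_B by (intro linearI)
    (simp_all add: real_vector.representation_add real_vector.representation_scale independent_B)

lemma dim_UNIV: "dim (UNIV :: 'a set) = card B"
  using real_vector.dim_eq_card[OF _ independent_B, of UNIV] span_B by simp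

text \<open>
  The ball is a closed subset of the image of a compact cube of coefficients.
\<close>

lemma compact_cball_basis: "compact (cball (0::'a) r)"
proof -
  obtain \<mu> where \<mu>: "\<mu> > 0" "\<And>x e. e \<in> B \<Longrightarrow> \<bar>coord x e\<bar> \<le> \<mu> * norm x"
    using coord_bound by blast
  define cube where "cube = PiE UNIV (\<lambda>e::'a. {- \<mu> * r .. \<mu> * r})"
  have "compact cube"
    unfolding cube_def by (rule compact_PiE_UNIV) auto
  then have "compact ((\<lambda>c. \<Sum>e\<in>B. c e *\<^sub>R e) ` cube)"
    by (rule compact_continuous_image[rotated]) (intro continuous_intros)
  then have "compact ((\<lambda>c. \<Sum>e\<in>B. c e *\<^sub>R e) ` cube \<inter> cball 0 r)"
    by (rule compact_Int_closed) simp
  moreover have "cball 0 r \<subseteq> (\<lambda>c. \<Sum>e\<in>B. c e *\<^sub>R e) ` cube"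
  proof
    fix x :: 'a assume "x \<in> cball 0 r"
    then have x: "norm x \<le> r" by simp
    let ?c = "\<lambda>e. if e \<in> B then coord x e else 0"
    have "\<bar>?c e\<bar> \<le> \<mu> * r" for e
    proof (cases "e \<in> B")
      case True
      then have "\<bar>coord x e\<bar> \<le> \<mu> * norm x" by (rule \<mu>)
      also have "\<dots> \<le> \<mu> * r" using x \<mu>(1) by simp
      finally show ?thesis using True by simp
    next
      case False
      have "0 \<le> r" using x norm_ge_zero order_trans by blast
      then show ?thesis using False \<mu>(1) by simp
    qed
    then have c: "?c \<in> cube"
      by (simp add: cube_def PiE_iff abs_le_iff minus_le_iff)
    have sum: "(\<Sum>e\<in>B. ?c e *\<^sub>R e) = x" using sum_coord[of x] by simp
    show "x \<in> (\<lambda>c. \<Sum>e\<in>B. c e *\<^sub>R e) ` cube"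
      by (rule image_eqI[where f = "\<lambda>c. \<Sum>e\<in>B. c e *\<^sub>R e", OF sum[symmetric] c])
  qed
  ultimately show ?thesis by (simp add: inf.absorb2)
qed

end

section \<open>The Mazur--Ulam theorem\<close>

lemma reflection_fixes_only_centre:
  fixes x z :: "'a::real_normed_vector"
  assumes "2 *\<^sub>R z - x = x"
  shows "x = z"
proof -
  have "2 *\<^sub>R z = 2 *\<^sub>R x" using assms by (simp add: scaleR_2 algebra_simps)
  then show ?thesis by simp
qed

lemma reflection_to_centre:
  fixes x z :: "'a::real_normed_vector"
  assumes "2 *\<^sub>R z - x = z"
  shows "x = z"
  using assms by (simp add: scaleR_2 algebra_simps)

lemma isometry_group_dist: "g \<in> isometry_group \<Longrightarrow> dist (g x) (g y) = dist x y"
  by (simp add: isometry_group_def)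

lemma isometry_group_comp: "g \<in> isometry_group \<Longrightarrow> h \<in> isometry_group \<Longrightarrow> g \<circ> h \<in> isometry_group"
  by (auto simp: isometry_group_def bij_comp)

lemma isometry_group_inv:
  assumes "g \<in> isometry_group" shows "inv g \<in> isometry_group"
proof -
  have g: "bij g" "\<And>x y. dist (g x) (g y) = dist x y"
    using assms by (auto simp: isometry_group_def)
  have "dist (inv g x) (inv g y) = dist x y" for x y
    using g(2)[of "inv g x" "inv g y"] g(1) by (simp add: bij_is_surj surj_f_inv_f)
  then show ?thesis using g(1) by (simp add: isometry_group_def bij_imp_bij_inv)
qed

lemma reflection_in_isometry_group:
  "(\<lambda>x. 2 *\<^sub>R z - x) \<in> (isometry_group :: ('a::real_normed_vector \<Rightarrow> 'a) set)"
proof -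
  have "bij (\<lambda>x. 2 *\<^sub>R z - x)"
    by (rule o_bij[of "\<lambda>x. 2 *\<^sub>R z - x"]) (auto simp: fun_eq_iff)
  moreover have "dist (2 *\<^sub>R z - x) (2 *\<^sub>R z - y) = dist x y" for x y
    by (simp add: dist_norm norm_minus_commute)
  ultimately show ?thesis by (simp add: isometry_group_def)
qed

text \<open>
  If \<open>h\<close> is an isometry that fixes \<open>x\<close> and \<open>y\<close>, and \<open>r\<close> is the reflection in their midpoint, then
  \<open>r \<circ> inv h \<circ> r \<circ> h\<close> also fixes them, and it moves the midpoint twice as far as \<open>h\<close>. Since the
  displacement is at most \<open>2 * dist x (midpoint x y)\<close>, repeated doubling forces it to vanish.
\<close>

lemma isometry_fixing_endpoints_fixes_midpoint:
  fixes x y :: "'a::real_normed_vector"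
  assumes "g \<in> isometry_group" "g x = x" "g y = y"
  shows "g (midpoint x y) = midpoint x y"
proof -
  define z where "z = midpoint x y"
  define W where "W = {g \<in> isometry_group. g x = x \<and> g y = y}"
  define r where "r u = 2 *\<^sub>R z - u" for u :: 'a
  have rxy: "r x = y" "r y = x"
    by (simp_all add: r_def z_def midpoint_def)
  have bdd: "dist (h z) z \<le> 2 * dist x z" if "h \<in> W" for h
  proof -
    have "dist (h z) z \<le> dist (h z) (h x) + dist x z"
      using that dist_triangle[of "h z" z x] by (simp add: W_def)
    also have "dist (h z) (h x) = dist z x"
      by (rule isometry_group_dist) (use that in \<open>simp add: W_def\<close>)
    also have "dist z x = dist x z" by (rule dist_commute)
    finally show ?thesis by simp
  qed
  have dbl: "\<exists>h'\<in>W. dist (h' z) z = 2 * dist (h z) z" if h: "h \<in> W" for h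
  proof
    have hi: "h \<in> isometry_group" and hxy: "h x = x" "h y = y" using h by (auto simp: W_def)
    have ri: "r \<in> isometry_group" unfolding r_def by (rule reflection_in_isometry_group)
    have inj: "inv h (h u) = u" for u
      using hi by (simp add: isometry_group_def bij_is_inj)
    let ?h = "r \<circ> inv h \<circ> r \<circ> h"
    show "?h \<in> W"
      using hi ri hxy rxy inj[of x] inj[of y]
      by (simp add: W_def isometry_group_comp isometry_group_inv)
    have "dist (?h z) z = dist (?h z) (r z)" by (simp add: r_def scaleR_2)
    also have "\<dots> = dist (inv h (r (h z))) z"
      using ri by (simp add: isometry_group_def)
    also have "\<dots> = dist (inv h (r (h z))) (inv h (h z))" by (simp add: inj)
    also have "\<dots> = dist (r (h z)) (h z)"
      using isometry_group_inv[OF hi] by (simp add: isometry_group_def)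
    also have "\<dots> = norm (2 *\<^sub>R (z - h z))"
      by (simp add: r_def dist_norm scaleR_2 algebra_simps)
    also have "\<dots> = 2 * dist (h z) z"
      by (simp add: dist_norm norm_minus_commute)
    finally show "dist (?h z) z = 2 * dist (h z) z" .
  qed
  have "\<exists>h\<in>W. dist (h z) z = 2 ^ n * dist (g z) z" for n
  proof (induction n)
    case 0
    show ?case using assms by (auto simp: W_def)
  next
    case (Suc n)
    then obtain h where "h \<in> W" "dist (h z) z = 2 ^ n * dist (g z) z" by blast
    then show ?case using dbl[of h] by (auto simp: mult.assoc)
  qed
  then have le: "2 ^ n * dist (g z) z \<le> 2 * dist x z" for n
    using bdd by metis
  have "dist (g z) z = 0"
  proof (rule ccontr)
    assume "dist (g z) z \<noteq> 0"
    then have pos: "dist (g z) z > 0" by (simp add: zero_less_dist_iff)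
    obtain n where "2 * dist x z / dist (g z) z < 2 ^ n"
      using real_arch_pow[of 2 "2 * dist x z / dist (g z) z"] by auto
    then show False using le[of n] pos by (simp add: field_simps)
  qed
  then show ?thesis by (simp add: z_def)
qed

text \<open>
  With \<open>r\<close> and \<open>r'\<close> the reflections in \<open>midpoint x y\<close> and \<open>midpoint (g x) (g y)\<close>, the isometry
  \<open>r \<circ> inv g \<circ> r' \<circ> g\<close> fixes \<open>x\<close> and \<open>y\<close>, hence their midpoint. So \<open>r'\<close> fixes
  \<open>g (midpoint x y)\<close>, and a reflection fixes only its centre.
\<close>

lemma isometry_preserves_midpoint:
  fixes x y :: "'a::real_normed_vector"
  assumes "g \<in> isometry_group"
  shows "g (midpoint x y) = midpoint (g x) (g y)"
proof -
  define r where "r u = 2 *\<^sub>R midpoint x y - u" for u :: 'a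
  define r' where "r' u = 2 *\<^sub>R midpoint (g x) (g y) - u" for u :: 'a
  have inj: "inv g (g u) = u" and surj: "g (inv g u) = u" for u
    using assms by (simp_all add: isometry_group_def bij_is_inj bij_is_surj surj_f_inv_f)
  have rxy: "r x = y" "r y = x" "r' (g x) = g y" "r' (g y) = g x"
    by (simp_all add: r_def r'_def midpoint_def)
  have "r \<circ> inv g \<circ> r' \<circ> g \<in> isometry_group"
    unfolding r_def r'_def
    by (intro isometry_group_comp isometry_group_inv reflection_in_isometry_group assms)
  then have "(r \<circ> inv g \<circ> r' \<circ> g) (midpoint x y) = midpoint x y"
    by (rule isometry_fixing_endpoints_fixes_midpoint) (simp_all add: rxy inj)
  then have "inv g (r' (g (midpoint x y))) = midpoint x y"
    unfolding r_def o_apply by (rule reflection_to_centre)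
  then have "r' (g (midpoint x y)) = g (midpoint x y)" using surj by metis
  then show ?thesis unfolding r'_def by (rule reflection_fixes_only_centre)
qed

text \<open>
  Additivity gives homogeneity over the rationals, and continuity extends it to the reals.
\<close>

lemma additive_norm_preserving_imp_linear:
  fixes f :: "'a::real_normed_vector \<Rightarrow> 'b::real_normed_vector"
  assumes add: "\<And>x y. f (x + y) = f x + f y" and iso: "\<And>x. norm (f x) = norm x"
  shows "linear f"
proof
  show "f (x + y) = f x + f y" for x y by (rule add)
  interpret additive f by unfold_locales (rule add)
  have nat: "f (real n *\<^sub>R x) = real n *\<^sub>R f x" for n x
    by (induction n) (simp_all add: zero scaleR_left_distrib add)
  have int: "f (of_int k *\<^sub>R x) = of_int k *\<^sub>R f x" for k x
    by (cases k rule: int_cases2) (simp_all add: nat minus)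
  have rat: "f (q *\<^sub>R x) = q *\<^sub>R f x" if q: "q \<in> \<rat>" for q x
  proof -
    obtain a b where ab: "b > 0" "q = of_int a / of_int b"
      using Rats_cases'[OF q] by metis
    then have "of_int b *\<^sub>R f (q *\<^sub>R x) = f (of_int b *\<^sub>R (q *\<^sub>R x))" by (simp only: int)
    also have "of_int b *\<^sub>R (q *\<^sub>R x) = of_int a *\<^sub>R x" using ab by simp
    also have "f \<dots> = of_int a *\<^sub>R f x" by (rule int)
    also have "\<dots> = of_int b *\<^sub>R (q *\<^sub>R f x)" using ab by simp
    finally show ?thesis
      using ab(1) by (metis less_irrefl of_int_eq_0_iff real_vector.scale_left_imp_eq)
  qed
  show "f (c *\<^sub>R x) = c *\<^sub>R f x" for c x
  proof -
    have lip: "dist (f y) (f z) = dist y z" for y z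
      using iso[of "y - z"] by (simp add: diff dist_norm)
    then have cf: "continuous_on UNIV f"
      by (metis continuous_on_iff)
    have "closed {t. f (t *\<^sub>R x) = t *\<^sub>R f x}"
      by (intro closed_Collect_eq continuous_intros continuous_on_compose2[OF cf]) auto
    moreover have "\<rat> \<subseteq> {t. f (t *\<^sub>R x) = t *\<^sub>R f x}" using rat by auto
    ultimately have "closure \<rat> \<subseteq> {t. f (t *\<^sub>R x) = t *\<^sub>R f x}"
      by (simp add: closure_minimal)
    then show ?thesis using Rats_closure_real by auto
  qed
qed

definition linear_isometries :: "('a::real_normed_vector \<Rightarrow> 'a) set" where
  "linear_isometries = {g. linear g \<and> (\<forall>x. norm (g x) = norm x)}"

lemma linear_isometries_comp:
  "g \<in> linear_isometries \<Longrightarrow> h \<in> linear_isometries \<Longrightarrow> g \<circ> h \<in> linear_isometries"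
  by (auto simp: linear_isometries_def intro: linear_compose)

text \<open>
  The Mazur--Ulam theorem. Preservation of midpoints is additivity once the value at \<open>0\<close> has been
  subtracted.
\<close>

theorem isometry_linear_part:
  assumes "g \<in> isometry_group"
  shows "(\<lambda>x. g x - g 0) \<in> linear_isometries"
proof -
  define f where "f x = g x - g 0" for x
  have half: "f ((1/2) *\<^sub>R (x + y)) = (1/2) *\<^sub>R (f x + f y)" for x y
  proof -
    have "g ((1/2) *\<^sub>R (x + y)) = (1/2) *\<^sub>R (g x + g y)"
      using isometry_preserves_midpoint[OF assms, of x y] by (simp add: midpoint_def)
    moreover have "g 0 = (1/2) *\<^sub>R (g 0 + g 0)" by (simp add: scaleR_2[symmetric])
    ultimately show ?thesis
      by (simp add: f_def algebra_simps)
  qed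
  have f0: "f 0 = 0" by (simp add: f_def)
  have dbl: "f (2 *\<^sub>R x) = 2 *\<^sub>R f x" for x
    using half[of "2 *\<^sub>R x" 0] by (simp add: f0)
  have add: "f (x + y) = f x + f y" for x y
    using half[of "2 *\<^sub>R x" "2 *\<^sub>R y"] by (simp add: dbl scaleR_right_distrib)
  have iso: "norm (f x) = norm x" for x
  proof -
    have "norm (f x) = dist (g x) (g 0)" by (simp add: f_def dist_norm)
    also have "\<dots> = dist x 0" using assms by (simp add: isometry_group_def)
    finally show ?thesis by simp
  qed
  show ?thesis
    using additive_norm_preserving_imp_linear[OF add iso] iso by (simp add: linear_isometries_def f_def)
qed

section \<open>An inner product invariant under linear isometries\<close>

context normed_basis
begin

lemma linear_isometry_inv:
  fixes g :: "'a \<Rightarrow> 'a"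
  assumes "g \<in> linear_isometries"
  shows "inv g \<in> linear_isometries" and "g (inv g x) = x" and "inv g (g x) = x"
proof -
  interpret fd: finite_dimensional_vector_space "(*\<^sub>R) :: real \<Rightarrow> 'a \<Rightarrow> 'a" B
    by unfold_locales
      (use finite_B independent_B span_B in \<open>simp_all add: dependent_raw_def[symmetric] span_raw_def[symmetric]\<close>)
  have g: "linear g" "\<And>x. norm (g x) = norm x"
    using assms by (auto simp: linear_isometries_def)
  have inj: "inj g"
    using g by (metis linear_injective_0 norm_eq_zero)
  have surj: "surj g"
    using fd.linear_inj_imp_surj[of g] g(1) inj by (simp add: linear_def)
  show gi: "g (inv g x) = x" for x using surj by (simp add: surj_f_inv_f)
  show ig: "inv g (g x) = x" for x using inj by simp
  have "linear (inv g)"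
  proof
    fix x y c
    have "x + y = g (inv g x + inv g y)" using g(1) gi by (simp add: linear_add)
    then show "inv g (x + y) = inv g x + inv g y" by (simp only: ig)
    have "c *\<^sub>R x = g (c *\<^sub>R inv g x)" using g(1) gi by (simp add: linear_scale)
    then show "inv g (c *\<^sub>R x) = c *\<^sub>R inv g x" by (simp only: ig)
  qed
  moreover have "norm (inv g x) = norm x" for x using g(2) gi by metis
  ultimately show "inv g \<in> linear_isometries" by (simp add: linear_isometries_def)
qed

text \<open>
  In the topology of pointwise convergence, the linear isometries form a closed subset of a product
  of balls, which is compact by Tychonoff's theorem.
\<close>

lemma compact_linear_isometries: "compact (linear_isometries :: ('a \<Rightarrow> 'a) set)"
proof -
  have cball: "compact (PiE UNIV (\<lambda>x::'a. cball (0::'a) (norm x)))"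
    by (rule compact_PiE_UNIV) (rule compact_cball_basis)
  have add: "closed {g :: 'a \<Rightarrow> 'a. \<forall>x y. g (x + y) = g x + g y}"
    by (intro closed_Collect_all closed_Collect_eq continuous_on_add continuous_on_evaluation)
  have scale: "closed {g :: 'a \<Rightarrow> 'a. \<forall>c x. g (c *\<^sub>R x) = c *\<^sub>R g x}"
    by (intro closed_Collect_all closed_Collect_eq continuous_on_scaleR continuous_on_const
        continuous_on_evaluation)
  have norm: "closed {g :: 'a \<Rightarrow> 'a. \<forall>x. norm (g x) = norm x}"
    by (intro closed_Collect_all closed_Collect_eq continuous_on_norm continuous_on_const
        continuous_on_evaluation)
  have eq: "(linear_isometries :: ('a \<Rightarrow> 'a) set) = PiE UNIV (\<lambda>x::'a. cball (0::'a) (norm x))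
      \<inter> ({g. \<forall>x y. g (x + y) = g x + g y} \<inter> ({g. \<forall>c x. g (c *\<^sub>R x) = c *\<^sub>R g x}
      \<inter> {g. \<forall>x. norm (g x) = norm x}))"
    by (auto simp: linear_isometries_def linear_iff PiE_iff)
  show ?thesis
    unfolding eq by (intro compact_Int_closed closed_Int cball add scale norm)
qed

lemma exists_comparable_inner_product:
  "\<exists>b M. inner_product b \<and> M > 0 \<and> (\<forall>x::'a. (norm x)\<^sup>2 \<le> b x x)
     \<and> (\<forall>x y. \<bar>b x y\<bar> \<le> M * norm x * norm y)"
proof -
  obtain \<mu> where \<mu>: "\<mu> > 0" "\<And>x e. e \<in> B \<Longrightarrow> \<bar>coord x e\<bar> \<le> \<mu> * norm x"
    using coord_bound by blast
  define k where "k = 1 + (\<Sum>e\<in>B. (norm e)\<^sup>2)"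
  have k: "k > 0" unfolding k_def by (simp add: add_pos_nonneg sum_nonneg)
  define b where "b x y = k * (\<Sum>e\<in>B. coord x e * coord y e)" for x y
  have lin: "coord (x + y) e = coord x e + coord y e" "coord (c *\<^sub>R x) e = c * coord x e" for x y e c
    using linear_coord[of e] by (simp_all add: linear_iff)
  have "bilinear b"
    unfolding bilinear_def linear_iff b_def
    by (simp add: lin algebra_simps sum.distrib sum_distrib_left)
  moreover have "b x y = b y x" for x y by (simp add: b_def mult.commute)
  moreover have lower: "(norm x)\<^sup>2 \<le> b x x" for x
  proof -
    have "norm x \<le> (\<Sum>e\<in>B. \<bar>coord x e\<bar> * norm e)"
      using norm_sum[of "\<lambda>e. coord x e *\<^sub>R e" B] by (simp add: sum_coord)
    then have "(norm x)\<^sup>2 \<le> (\<Sum>e\<in>B. \<bar>coord x e\<bar> * norm e)\<^sup>2" by (simp add: power_mono)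
    also have "\<dots> \<le> (\<Sum>e\<in>B. \<bar>coord x e\<bar>\<^sup>2) * (\<Sum>e\<in>B. (norm e)\<^sup>2)"
      by (rule Cauchy_Schwarz_ineq_sum)
    also have "\<dots> \<le> (\<Sum>e\<in>B. \<bar>coord x e\<bar>\<^sup>2) * k"
      by (rule mult_left_mono) (simp_all add: k_def sum_nonneg)
    also have "\<dots> = b x x" by (simp add: b_def power2_eq_square mult.commute)
    finally show ?thesis .
  qed
  moreover have "b x x > 0" if "x \<noteq> 0" for x
    using lower[of x] that by (metis less_le_trans zero_less_norm_iff zero_less_power)
  moreover have "\<bar>b x y\<bar> \<le> (k * (\<mu>\<^sup>2 * real (card B)) + 1) * norm x * norm y" for x y
  proof -
    have "\<bar>\<Sum>e\<in>B. coord x e * coord y e\<bar> \<le> (\<Sum>e\<in>B. (\<mu> * norm x) * (\<mu> * norm y))"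
      by (rule order_trans[OF sum_abs], rule sum_mono)
        (use \<mu> in \<open>simp add: abs_mult mult_mono'\<close>)
    also have "\<dots> = \<mu>\<^sup>2 * real (card B) * (norm x * norm y)"
      by (simp add: power2_eq_square)
    finally have "\<bar>b x y\<bar> \<le> k * (\<mu>\<^sup>2 * real (card B) * (norm x * norm y))"
      using k by (simp add: b_def abs_mult)
    also have "\<dots> \<le> (k * (\<mu>\<^sup>2 * real (card B)) + 1) * norm x * norm y"
      by (simp add: algebra_simps)
    finally show ?thesis .
  qed
  moreover have "k * (\<mu>\<^sup>2 * real (card B)) + 1 > 0"
    using k \<mu>(1) by (simp add: add_nonneg_pos)
  ultimately show ?thesis unfolding inner_product_def by blast
qed

text \<open>
  This is the squared Hilbert--Schmidt norm of the pullback of the form \<open>b\<close> by \<open>g\<close>, relative to the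
  basis \<open>B\<close>. Forms take a pair as argument so that a space of forms is a plain function space, to
  which Tychonoff's theorem applies.
\<close>

definition energy :: "('a \<Rightarrow> 'a) \<Rightarrow> ('a \<times> 'a \<Rightarrow> real) \<Rightarrow> real" where
  "energy g b = (\<Sum>(e, e')\<in>B \<times> B. (b (g e, g e'))\<^sup>2)"

text \<open>
  The vectors \<open>g e\<close> with \<open>e \<in> B\<close> form a basis in which every vector has the coordinates that its
  preimage has in \<open>B\<close>, and \<open>g\<close> preserves norms. So these coordinates are bounded independently
  of \<open>g\<close>. The uniformity in \<open>g\<close> is what makes the supremum of the energies strictly convex.
\<close>

lemma energy_bounds_form:
  assumes "bilinear D"
  shows "\<exists>K>0. \<forall>g\<in>linear_isometries. (D x y)\<^sup>2 \<le> K * energy g (\<lambda>(u, v). D u v)"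
proof -
  obtain \<mu> where \<mu>: "\<mu> > 0" "\<And>x e. e \<in> B \<Longrightarrow> \<bar>coord x e\<bar> \<le> \<mu> * norm x"
    using coord_bound by blast
  define L where "L = (\<mu> * norm x) * (\<mu> * norm y)"
  define K where "K = L\<^sup>2 * real (card (B \<times> B)) + 1"
  have "(D x y)\<^sup>2 \<le> K * energy g (\<lambda>(u, v). D u v)" if g: "g \<in> linear_isometries" for g
  proof -
    let ?c = "\<lambda>z. coord (inv g z)"
    have "linear g" using g by (simp add: linear_isometries_def)
    have exp: "z = (\<Sum>e\<in>B. ?c z e *\<^sub>R g e)" for z
    proof -
      have "z = g (inv g z)" using linear_isometry_inv[OF g] by simp
      also have "\<dots> = g (\<Sum>e\<in>B. ?c z e *\<^sub>R e)" by (simp only: sum_coord)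
      also have "\<dots> = (\<Sum>e\<in>B. ?c z e *\<^sub>R g e)"
        using \<open>linear g\<close> by (simp add: linear_sum linear_scale)
      finally show ?thesis .
    qed
    have bnd: "\<bar>?c z e\<bar> \<le> \<mu> * norm z" if "e \<in> B" for z e
      using \<mu>(2)[OF that, of "inv g z"] linear_isometry_inv(1)[OF g]
      by (simp add: linear_isometries_def)
    have "D x y = D (\<Sum>e\<in>B. ?c x e *\<^sub>R g e) (\<Sum>e\<in>B. ?c y e *\<^sub>R g e)"
      using exp[of x] exp[of y] by simp
    also have "\<dots> = (\<Sum>(e, e')\<in>B \<times> B. D (?c x e *\<^sub>R g e) (?c y e' *\<^sub>R g e'))"
      by (rule bilinear_sum[OF assms])
    also have "\<dots> = (\<Sum>(e, e')\<in>B \<times> B. ?c x e * ?c y e' * D (g e) (g e'))"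
      by (rule sum.cong) (auto simp: bilinear_lmul[OF assms] bilinear_rmul[OF assms])
    finally have "(D x y)\<^sup>2 \<le> (\<Sum>z\<in>B \<times> B. (case z of (e, e') \<Rightarrow> ?c x e * ?c y e' * D (g e) (g e'))\<^sup>2)
        * real (card (B \<times> B))"
      by (simp only: sum_squared_le_sum_of_squares)
    also have "\<dots> \<le> (\<Sum>(e, e')\<in>B \<times> B. L\<^sup>2 * (D (g e) (g e'))\<^sup>2) * real (card (B \<times> B))"
    proof (intro mult_right_mono sum_mono)
      fix z assume "z \<in> B \<times> B"
      then obtain e e' where z: "z = (e, e')" "e \<in> B" "e' \<in> B" by blast
      have "\<bar>?c x e * ?c y e'\<bar> \<le> L"
        unfolding abs_mult L_def by (intro mult_mono bnd z) (use \<mu> in auto)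
      then have "(?c x e * ?c y e')\<^sup>2 \<le> L\<^sup>2"
        by (metis abs_ge_zero power2_abs power_mono)
      then show "(case z of (e, e') \<Rightarrow> ?c x e * ?c y e' * D (g e) (g e'))\<^sup>2
          \<le> (case z of (e, e') \<Rightarrow> L\<^sup>2 * (D (g e) (g e'))\<^sup>2)"
        by (simp add: z power_mult_distrib mult_right_mono)
    qed simp
    also have "\<dots> = L\<^sup>2 * real (card (B \<times> B)) * energy g (\<lambda>(u, v). D u v)"
      by (simp add: energy_def sum_distrib_left case_prod_unfold mult_ac)
    also have "\<dots> \<le> K * energy g (\<lambda>(u, v). D u v)"
      unfolding K_def energy_def by (rule mult_right_mono) (auto intro: sum_nonneg)
    finally show ?thesis .
  qed
  moreover have "K > 0" by (simp add: K_def add_nonneg_pos)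
  ultimately show ?thesis by blast
qed

text \<open>
  This replaces averaging over Haar measure by a minimisation. Consider the symmetric bilinear forms
  \<open>b\<close> with \<open>(norm x)\<^sup>2 \<le> b (x, x)\<close> and \<open>\<bar>b (x, y)\<bar> \<le> M * norm x * norm y\<close>. They form a compact
  convex set on which the linear isometries act by pullback, because both bounds involve only
  norms. The largest energy of \<open>b\<close>, taken over all linear isometries, is unchanged by this action.
  It has a minimiser by compactness and only one by the parallelogram law, so the minimiser is
  invariant.
\<close>

theorem exists_invariant_inner_product:
  "\<exists>ip M. inner_product ip \<and> (\<forall>x y. \<bar>ip x y\<bar> \<le> M * norm x * norm y)
     \<and> (\<forall>g\<in>linear_isometries. \<forall>x y :: 'a. ip (g x) (g y) = ip x y)"
proof -
  obtain b0 M where b0: "inner_product b0" "M > 0" "\<And>x::'a. (norm x)\<^sup>2 \<le> b0 x x"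
      "\<And>x y. \<bar>b0 x y\<bar> \<le> M * norm x * norm y"
    using exists_comparable_inner_product by metis
  define box where "box = PiE UNIV (\<lambda>(x::'a, y::'a). {- (M * norm x * norm y) .. M * norm x * norm y})"
  define forms where "forms = {b. (\<forall>x y. b (x, y) = b (y, x))
      \<and> (\<forall>x y z. b (x + y, z) = b (x, z) + b (y, z)) \<and> (\<forall>c x z. b (c *\<^sub>R x, z) = c * b (x, z))
      \<and> (\<forall>x::'a. (norm x)\<^sup>2 \<le> b (x, x))}"
  define C where "C = box \<inter> forms"
  have C_iff: "b \<in> C \<longleftrightarrow> (\<forall>x y. \<bar>b (x, y)\<bar> \<le> M * norm x * norm y) \<and> b \<in> forms" for b
    by (auto simp: C_def box_def PiE_iff abs_le_iff minus_le_iff)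
  have "compact box"
    unfolding box_def by (rule compact_PiE_UNIV) auto
  moreover have "closed forms"
    unfolding forms_def
    by (intro closed_Collect_conj closed_Collect_all closed_Collect_eq closed_Collect_le
        continuous_on_add continuous_on_mult continuous_on_const continuous_on_evaluation)
  ultimately have "compact C" unfolding C_def by (rule compact_Int_closed)
  have bil: "bilinear (\<lambda>x y. b (x, y))" if "b \<in> C" for b
  proof -
    have b: "b (x, y) = b (y, x)" "b (x + y, z) = b (x, z) + b (y, z)"
      "b (c *\<^sub>R x, z) = c * b (x, z)" for x y z c
      using that unfolding C_iff forms_def by blast+
    have "b (z, x + y) = b (z, x) + b (z, y)" "b (z, c *\<^sub>R x) = c * b (z, x)" for x y z c
      using b(2)[of x y z] b(3)[of c x z] by (simp_all add: b(1)[of z])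
    then show ?thesis using b(2,3) by (simp add: bilinear_def linear_iff)
  qed
  \<comment> \<open>an element of \<open>R\<close> is an upper bound for all energies of some admissible form,
    so the infimum of \<open>R\<close> is the minimum to be attained\<close>
  define R where "R = {r. \<exists>b\<in>C. \<forall>g\<in>linear_isometries. energy g b \<le> r}"
  have b0C: "(\<lambda>(x, y). b0 x y) \<in> C"
  proof -
    have bil0: "bilinear b0" and sym0: "\<And>x y. b0 x y = b0 y x"
      using b0(1) by (auto simp: inner_product_def)
    have "\<forall>x y. b0 x y = b0 y x" using sym0 by blast
    then show ?thesis
      using b0(3,4) bilinear_ladd[OF bil0] bilinear_lmul[OF bil0]
      by (simp only: C_iff forms_def mem_Collect_eq case_prod_conv real_scaleR_def) blast
  qed
  have "(\<Sum>(e, e')\<in>B \<times> B. (M * norm e * norm e')\<^sup>2) \<in> R"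
  proof -
    have "energy g (\<lambda>(x, y). b0 x y) \<le> (\<Sum>(e, e')\<in>B \<times> B. (M * norm e * norm e')\<^sup>2)"
      if "g \<in> linear_isometries" for g
    proof -
      have "\<bar>b0 (g e) (g e')\<bar> \<le> M * norm e * norm e'" for e e'
        using b0(4)[of "g e" "g e'"] that by (simp add: linear_isometries_def)
      then have "(b0 (g e) (g e'))\<^sup>2 \<le> (M * norm e * norm e')\<^sup>2" for e e'
        by (metis abs_ge_zero power2_abs power_mono)
      then show ?thesis unfolding energy_def by (intro sum_mono) auto
    qed
    then show ?thesis using b0C unfolding R_def by blast
  qed
  then have "R \<noteq> {}" by blast
  have id: "id \<in> (linear_isometries :: ('a \<Rightarrow> 'a) set)"
    by (simp add: linear_isometries_def linear_iff)
  have energy_nonneg: "energy g b \<ge> 0" for g b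
    unfolding energy_def by (rule sum_nonneg) auto
  have "bdd_below R"
    unfolding R_def using id energy_nonneg by (intro bdd_belowI[of _ 0]) (auto intro: order_trans)
  define m where "m = Inf R"
  \<comment> \<open>the infimum is attained: the sublevel sets above it are nested, closed and non-empty\<close>
  have "C \<inter> (\<Inter>r\<in>{m<..}. {b. \<forall>g\<in>linear_isometries. energy g b \<le> r}) \<noteq> {}"
  proof (rule compact_imp_fip_image[OF \<open>compact C\<close>])
    fix r
    show "closed {b. \<forall>g\<in>linear_isometries. energy g b \<le> r}"
      unfolding energy_def case_prod_unfold Ball_def
      by (intro closed_Collect_all closed_Collect_imp open_Collect_const closed_Collect_le
          continuous_on_sum continuous_on_power continuous_on_const continuous_on_evaluation)
  next
    fix I assume I: "finite I" "I \<subseteq> {m<..}"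
    define s where "s = Min (insert (m + 1) I)"
    have "s > m" using I by (auto simp: s_def)
    then obtain r where "r \<in> R" "r < s"
      using cInf_lessD[OF \<open>R \<noteq> {}\<close>] unfolding m_def by blast
    then obtain b where b: "b \<in> C" "\<And>g. g \<in> linear_isometries \<Longrightarrow> energy g b \<le> s"
      unfolding R_def by fastforce
    have "s \<le> i" if "i \<in> I" for i using I that by (simp add: s_def)
    then have "b \<in> C \<inter> (\<Inter>r\<in>I. {b. \<forall>g\<in>linear_isometries. energy g b \<le> r})"
      using b by (auto intro: order_trans)
    then show "C \<inter> (\<Inter>r\<in>I. {b. \<forall>g\<in>linear_isometries. energy g b \<le> r}) \<noteq> {}" by blast
  qed
  then obtain b where b: "b \<in> C" "\<And>r g. r > m \<Longrightarrow> g \<in> linear_isometries \<Longrightarrow> energy g b \<le> r"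
    by blast
  have b_min: "energy g b \<le> m" if "g \<in> linear_isometries" for g
    using b(2) that by (meson dense_ge)
  have unique: "b' = b"
    if b': "b' \<in> C" "\<And>g. g \<in> linear_isometries \<Longrightarrow> energy g b' \<le> m" for b'
  proof (rule ccontr)
    assume "b' \<noteq> b"
    define D where "D x y = b' (x, y) - b (x, y)" for x y
    obtain x y where xy: "D x y \<noteq> 0" using \<open>b' \<noteq> b\<close> by (auto simp: D_def fun_eq_iff)
    have "bilinear D"
      using bil[OF b(1)] bil[OF b'(1)] unfolding bilinear_def linear_iff D_def
      by (simp add: algebra_simps)
    from energy_bounds_form[OF this] obtain K where K: "K > 0"
      "\<And>g. g \<in> linear_isometries \<Longrightarrow> (D x y)\<^sup>2 \<le> K * energy g (\<lambda>(u, v). D u v)" by blast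
    \<comment> \<open>two different minimisers would have a midpoint whose largest energy is smaller by a fixed amount\<close>
    define mid where "mid z = (1/2) * (b' z + b z)" for z
    have "mid \<in> C"
    proof -
      have "\<bar>mid (x, y)\<bar> \<le> M * norm x * norm y" for x y
      proof -
        have "\<bar>b' (x, y)\<bar> \<le> M * norm x * norm y" "\<bar>b (x, y)\<bar> \<le> M * norm x * norm y"
          using b(1) b'(1) unfolding C_iff by blast+
        then show ?thesis by (simp add: mid_def abs_le_iff)
      qed
      moreover have "mid \<in> forms"
      proof -
        have f: "b \<in> forms" "b' \<in> forms" using b(1) b'(1) by (auto simp: C_iff)
        have "(norm x)\<^sup>2 \<le> mid (x, x)" for x
        proof -
          have "(norm x)\<^sup>2 \<le> b (x, x)" "(norm x)\<^sup>2 \<le> b' (x, x)"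
            using f unfolding forms_def by blast+
          then show ?thesis by (simp add: mid_def)
        qed
        moreover have "mid (x, y) = mid (y, x)" for x y
          using f unfolding forms_def mid_def by auto
        moreover have "mid (x + y, z) = mid (x, z) + mid (y, z)" for x y z
          using f unfolding forms_def mid_def by (auto simp: field_simps)
        moreover have "mid (c *\<^sub>R x, z) = c * mid (x, z)" for c x z
          using f unfolding forms_def mid_def by (auto simp: field_simps)
        ultimately show ?thesis unfolding forms_def by blast
      qed
      ultimately show ?thesis unfolding C_iff by blast
    qed
    have par: "energy g mid = (energy g b' + energy g b) / 2 - energy g (\<lambda>(u, v). D u v) / 4" for g
    proof -
      have "energy g mid = (\<Sum>z\<in>B \<times> B. ((b' (g (fst z), g (snd z)))\<^sup>2 + (b (g (fst z), g (snd z)))\<^sup>2) / 2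
          - (D (g (fst z)) (g (snd z)))\<^sup>2 / 4)"
        unfolding energy_def case_prod_unfold
        by (rule sum.cong) (auto simp: mid_def D_def power2_eq_square field_simps)
      then show ?thesis
        unfolding energy_def case_prod_unfold
        by (simp add: sum_subtractf sum.distrib sum_divide_distrib[symmetric])
    qed
    have "energy g mid \<le> m - (D x y)\<^sup>2 / (4 * K)" if g: "g \<in> linear_isometries" for g
    proof -
      have "(D x y)\<^sup>2 / K \<le> energy g (\<lambda>(u, v). D u v)"
        using K(1) K(2)[OF g] by (simp add: field_simps)
      then have "(D x y)\<^sup>2 / (4 * K) \<le> energy g (\<lambda>(u, v). D u v) / 4" by simp
      then show ?thesis
        using par[of g] b_min[OF g] b'(2)[OF g] by (simp add: field_simps)
    qed
    then have "m - (D x y)\<^sup>2 / (4 * K) \<in> R"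
      using \<open>mid \<in> C\<close> unfolding R_def by blast
    then have "m \<le> m - (D x y)\<^sup>2 / (4 * K)"
      unfolding m_def using \<open>bdd_below R\<close> by (rule cInf_lower)
    moreover have "(D x y)\<^sup>2 / (4 * K) > 0" using xy K(1) by simp
    ultimately show False by simp
  qed
  have inv: "b (g x, g y) = b (x, y)" if g: "g \<in> linear_isometries" for g x y
  proof -
    have lin: "linear g" "\<And>x. norm (g x) = norm x" using g by (auto simp: linear_isometries_def)
    define b' where "b' z = b (g (fst z), g (snd z))" for z
    have "b' \<in> C"
    proof -
      have f: "b \<in> forms" using b(1) by (simp add: C_iff)
      have "\<bar>b' (x, y)\<bar> \<le> M * norm x * norm y" for x y
        using b(1) lin(2) unfolding C_iff b'_def by (metis fst_conv snd_conv)
      moreover have "b' \<in> forms"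
      proof -
        have "(norm x)\<^sup>2 \<le> b' (x, x)" for x
        proof -
          have "(norm (g x))\<^sup>2 \<le> b (g x, g x)" using f unfolding forms_def by blast
          then show ?thesis by (simp add: b'_def lin(2))
        qed
        moreover have "b' (x, y) = b' (y, x)" for x y
          using f unfolding forms_def b'_def by auto
        moreover have "b' (x + y, z) = b' (x, z) + b' (y, z)" for x y z
          using f lin(1) unfolding forms_def b'_def by (auto simp: linear_add)
        moreover have "b' (c *\<^sub>R x, z) = c * b' (x, z)" for c x z
          using f lin(1) unfolding forms_def b'_def by (auto simp: linear_scale)
        ultimately show ?thesis unfolding forms_def by blast
      qed
      ultimately show ?thesis unfolding C_iff by blast
    qed
    moreover have "energy h b' \<le> m" if "h \<in> linear_isometries" for h
      using b_min[OF linear_isometries_comp[OF g that]] by (simp add: energy_def b'_def)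
    ultimately have "b' = b" by (rule unique)
    then have "b' (x, y) = b (x, y)" by simp
    then show ?thesis by (simp add: b'_def)
  qed
  have "inner_product (\<lambda>x y. b (x, y))"
  proof -
    have "b (x, y) = b (y, x)" "(norm x)\<^sup>2 \<le> b (x, x)" for x y
      using b(1) unfolding C_iff forms_def by blast+
    then show ?thesis
      unfolding inner_product_def
      using bil[OF b(1)] by (metis less_le_trans zero_less_norm_iff zero_less_power)
  qed
  moreover have "\<bar>b (x, y)\<bar> \<le> M * norm x * norm y" for x y
    using b(1) unfolding C_iff by blast
  ultimately show ?thesis using inv by blast
qed

end

section \<open>Velocities of trivial flexes\<close>

locale invariant_inner_product = normed_basis B for B :: "'a::real_normed_vector set" +
  fixes ip :: "'a \<Rightarrow> 'a \<Rightarrow> real" and M :: real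
  assumes inner_product: "inner_product ip"
    and bounded: "\<bar>ip x y\<bar> \<le> M * norm x * norm y"
    and invariant: "g \<in> linear_isometries \<Longrightarrow> ip (g x) (g y) = ip x y"
begin

lemma bilinear_ip: "bilinear ip" and ip_sym: "ip x y = ip y x" and ip_pos: "x \<noteq> 0 \<Longrightarrow> ip x x > 0"
  using inner_product by (auto simp: inner_product_def)

lemma ip_self_eq_0: "ip x x = 0 \<longleftrightarrow> x = 0"
  using ip_pos[of x] bilinear_lzero[OF bilinear_ip] by (cases "x = 0") auto

lemma bounded_bilinear_ip: "bounded_bilinear ip"
proof
  show "\<exists>K. \<forall>x y. norm (ip x y) \<le> norm x * norm y * K"
    using bounded by (intro exI[of _ M]) (simp add: mult_ac)
qed (simp_all add: bilinear_ladd bilinear_radd bilinear_lmul bilinear_rmul bilinear_ip)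

sublocale ip: bounded_bilinear ip
  by (rule bounded_bilinear_ip)

text \<open>
  Kills a velocity by finitely many linear conditions, which is how dimensions are counted below.
\<close>

lemma orthogonal_to_spanning_set:
  assumes "\<And>r. r \<in> R \<Longrightarrow> ip x r = 0" "span R = UNIV"
  shows "x = 0"
proof -
  have "subspace {r. ip x r = 0}"
    by (simp add: subspace_def ip.add_right ip.scaleR_right ip.zero_right)
  then have "span R \<subseteq> {r. ip x r = 0}" using assms(1) by (intro span_minimal) auto
  then have "ip x x = 0" using assms(2) by auto
  then show ?thesis by (simp add: ip_self_eq_0)
qed

end

lemma orbit_difference:
  assumes "(\<lambda>v\<in>V. f v) \<in> orbit V p"
  shows "\<exists>L\<in>linear_isometries. \<forall>a\<in>V. \<forall>b\<in>V. f a - f b = L (p a - p b)"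
proof -
  obtain g where g: "g \<in> isometry_group" "(\<lambda>v\<in>V. f v) = (\<lambda>v\<in>V. g (p v))"
    using assms by (auto simp: orbit_def)
  have fg: "f v = g (p v)" if "v \<in> V" for v
    using fun_cong[OF g(2), of v] that by simp
  define L where "L = (\<lambda>x. g x - g 0)"
  have L: "L \<in> linear_isometries" unfolding L_def by (rule isometry_linear_part[OF g(1)])
  then have "linear L" by (simp add: linear_isometries_def)
  then have "f a - f b = L (p a - p b)" if "a \<in> V" "b \<in> V" for a b
    unfolding linear_diff[OF \<open>linear L\<close>] using fg that by (simp add: L_def)
  then show ?thesis using L by blast
qed

text \<open>
  Along a trivial motion all differences of positions are moved by one linear isometry \<open>L t\<close>. Nothing
  is said about how \<open>L t\<close> depends on \<open>t\<close>: when the placement does not span, the motion of the points need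
  not determine it.
\<close>

lemma trivial_flexE:
  assumes "trivial_flex V p u"
  obtains \<delta> \<alpha> L where "\<delta> > 0" "\<And>v. v \<in> V \<Longrightarrow> \<alpha> v 0 = p v"
    "\<And>v. v \<in> V \<Longrightarrow> (\<alpha> v has_vector_derivative u v) (at 0)"
    "\<And>t. t \<in> {-\<delta><..<\<delta>} \<Longrightarrow> L t \<in> linear_isometries"
    "\<And>t a b. t \<in> {-\<delta><..<\<delta>} \<Longrightarrow> a \<in> V \<Longrightarrow> b \<in> V \<Longrightarrow> \<alpha> a t - \<alpha> b t = L t (p a - p b)"
proof -
  obtain \<delta> \<alpha> where \<alpha>: "\<delta> > 0" "\<And>v. v \<in> V \<Longrightarrow> \<alpha> v 0 = p v"
    "\<And>v. v \<in> V \<Longrightarrow> (\<alpha> v has_vector_derivative u v) (at 0)"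
    "\<And>t. t \<in> {-\<delta><..<\<delta>} \<Longrightarrow> (\<lambda>v\<in>V. \<alpha> v t) \<in> orbit V p"
    using assms unfolding trivial_flex_def by blast
  have "\<forall>t\<in>{-\<delta><..<\<delta>}. \<exists>L. L \<in> linear_isometries
      \<and> (\<forall>a\<in>V. \<forall>b\<in>V. \<alpha> a t - \<alpha> b t = L (p a - p b))"
    using orbit_difference[OF \<alpha>(4)] by blast
  then obtain L where "\<forall>t\<in>{-\<delta><..<\<delta>}. L t \<in> linear_isometries
      \<and> (\<forall>a\<in>V. \<forall>b\<in>V. \<alpha> a t - \<alpha> b t = L t (p a - p b))"
    by metis
  then show ?thesis using that[of \<delta> \<alpha> L] \<alpha>(1-3) by blast
qed

text \<open>
  The relation holds for the moving points at all times, as \<open>L t\<close> is linear. Differentiate it at \<open>0\<close>.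
\<close>

lemma trivial_flex_preserves_affine_relations:
  assumes triv: "trivial_flex V p u" and V: "v \<in> V" "z \<in> V" "S \<subseteq> V"
    and rel: "p z - p v = (\<Sum>s\<in>S. c s *\<^sub>R (p s - p v))"
  shows "u z - u v = (\<Sum>s\<in>S. c s *\<^sub>R (u s - u v))"
proof -
  obtain \<delta> \<alpha> L where \<alpha>: "\<delta> > 0"
    "\<And>v. v \<in> V \<Longrightarrow> (\<alpha> v has_vector_derivative u v) (at 0)"
    "\<And>t. t \<in> {-\<delta><..<\<delta>} \<Longrightarrow> L t \<in> linear_isometries"
    "\<And>t a b. t \<in> {-\<delta><..<\<delta>} \<Longrightarrow> a \<in> V \<Longrightarrow> b \<in> V \<Longrightarrow> \<alpha> a t - \<alpha> b t = L t (p a - p b)"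
    using trivial_flexE[OF triv] by metis
  have eq: "\<alpha> z t - \<alpha> v t = (\<Sum>s\<in>S. c s *\<^sub>R (\<alpha> s t - \<alpha> v t))" if t: "t \<in> {-\<delta><..<\<delta>}" for t
  proof -
    have "linear (L t)" using \<alpha>(3)[OF t] by (simp add: linear_isometries_def)
    have "\<alpha> z t - \<alpha> v t = (\<Sum>s\<in>S. c s *\<^sub>R L t (p s - p v))"
      using \<alpha>(4)[OF t V(2,1)] \<open>linear (L t)\<close> by (simp add: rel linear_sum linear_scale)
    also have "\<dots> = (\<Sum>s\<in>S. c s *\<^sub>R (\<alpha> s t - \<alpha> v t))"
      by (rule sum.cong) (use \<alpha>(4)[OF t _ V(1)] V(3) in auto)
    finally show ?thesis .
  qed
  have "((\<lambda>t. \<alpha> z t - \<alpha> v t) has_vector_derivative (u z - u v)) (at 0)"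
    using V by (intro has_vector_derivative_diff \<alpha>(2)) auto
  moreover have "((\<lambda>t. \<Sum>s\<in>S. c s *\<^sub>R (\<alpha> s t - \<alpha> v t)) has_vector_derivative
      (\<Sum>s\<in>S. c s *\<^sub>R (u s - u v))) (at 0)"
    using V by (intro has_vector_derivative_sum
        bounded_linear.has_vector_derivative[OF bounded_linear_scaleR_right]
        has_vector_derivative_diff \<alpha>(2)) auto
  then have "((\<lambda>t. \<alpha> z t - \<alpha> v t) has_vector_derivative (\<Sum>s\<in>S. c s *\<^sub>R (u s - u v))) (at 0)"
    by (rule has_vector_derivative_transform_within_open[where S = "{-\<delta><..<\<delta>}"])
      (use \<alpha>(1) eq in auto)
  ultimately show ?thesis by (rule vector_derivative_unique_at)
qed

context invariant_inner_product
begin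

text \<open>
  \<open>L t\<close> preserves the inner product, so the squared Euclidean distance of the two moving points is
  constant and its derivative vanishes.
\<close>

lemma trivial_flex_orthogonal:
  assumes triv: "trivial_flex V p u" and V: "a \<in> V" "b \<in> V"
  shows "ip (u a - u b) (p a - p b) = 0"
proof -
  obtain \<delta> \<alpha> L where \<alpha>: "\<delta> > 0" "\<And>v. v \<in> V \<Longrightarrow> \<alpha> v 0 = p v"
    "\<And>v. v \<in> V \<Longrightarrow> (\<alpha> v has_vector_derivative u v) (at 0)"
    "\<And>t. t \<in> {-\<delta><..<\<delta>} \<Longrightarrow> L t \<in> linear_isometries"
    "\<And>t a b. t \<in> {-\<delta><..<\<delta>} \<Longrightarrow> a \<in> V \<Longrightarrow> b \<in> V \<Longrightarrow> \<alpha> a t - \<alpha> b t = L t (p a - p b)"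
    using trivial_flexE[OF triv] by metis
  define h where "h t = \<alpha> a t - \<alpha> b t" for t
  have h: "(h has_vector_derivative (u a - u b)) (at 0)"
    unfolding h_def using V by (intro has_vector_derivative_diff \<alpha>(3))
  have "((\<lambda>t. ip (h t) (h t)) has_vector_derivative
      (ip (h 0) (u a - u b) + ip (u a - u b) (h 0))) (at 0)"
    by (rule ip.has_vector_derivative[OF h h])
  moreover have "ip (p a - p b) (p a - p b) = ip (h t) (h t)" if t: "t \<in> {-\<delta><..<\<delta>}" for t
    using invariant[OF \<alpha>(4)[OF t]] \<alpha>(5)[OF t V] by (simp add: h_def)
  then have "((\<lambda>t. ip (h t) (h t)) has_vector_derivative 0) (at 0)"
    by (intro has_vector_derivative_transform_within_open[where S = "{-\<delta><..<\<delta>}",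
          OF has_vector_derivative_const[of "ip (p a - p b) (p a - p b)"]]) (use \<alpha>(1) in auto)
  ultimately have "ip (h 0) (u a - u b) + ip (u a - u b) (h 0) = 0"
    by (rule vector_derivative_unique_at)
  then show ?thesis using \<alpha>(2) V ip_sym[of "h 0"] by (simp add: h_def)
qed

text \<open>
  Take \<open>g\<close> so that \<open>ip y (g q)\<close> is largest, where \<open>q = p w - p v\<close>. The motion carries \<open>q\<close> to
  \<open>L t q\<close>, and since \<open>g \<circ> L t\<close> competes in the maximum, \<open>ip y (g (L t q))\<close> is largest at
  \<open>t = 0\<close>. Its derivative there is the inner product of \<open>u w - u v\<close> with \<open>inv g y\<close>.
\<close>

lemma trivial_flex_critical:
  assumes triv: "trivial_flex V p u" and V: "v \<in> V" "w \<in> V"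
    and g: "g \<in> linear_isometries"
    and max: "\<And>L. L \<in> linear_isometries \<Longrightarrow> ip y (L (p w - p v)) \<le> ip y (g (p w - p v))"
  shows "ip (u w - u v) (inv g y) = 0"
proof -
  obtain \<delta> \<alpha> L where \<alpha>: "\<delta> > 0" "\<And>v. v \<in> V \<Longrightarrow> \<alpha> v 0 = p v"
    "\<And>v. v \<in> V \<Longrightarrow> (\<alpha> v has_vector_derivative u v) (at 0)"
    "\<And>t. t \<in> {-\<delta><..<\<delta>} \<Longrightarrow> L t \<in> linear_isometries"
    "\<And>t a b. t \<in> {-\<delta><..<\<delta>} \<Longrightarrow> a \<in> V \<Longrightarrow> b \<in> V \<Longrightarrow> \<alpha> a t - \<alpha> b t = L t (p a - p b)"
    using trivial_flexE[OF triv] by metis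
  have pull: "ip (inv g y) x = ip y (g x)" for x
    using invariant[OF g, of "inv g y" x] linear_isometry_inv(2)[OF g] by simp
  define h where "h t = ip (inv g y) (\<alpha> w t - \<alpha> v t)" for t
  have "(h has_vector_derivative ip (inv g y) (u w - u v)) (at 0)"
    unfolding h_def using V
    by (intro bounded_linear.has_vector_derivative[OF ip.bounded_linear_right]
        has_vector_derivative_diff \<alpha>(3))
  then have "DERIV h 0 :> ip (inv g y) (u w - u v)"
    by (simp add: has_real_derivative_iff_has_vector_derivative)
  moreover have "\<forall>t. \<bar>0 - t\<bar> < \<delta> \<longrightarrow> h t \<le> h 0"
  proof (intro allI impI)
    fix t :: real assume "\<bar>0 - t\<bar> < \<delta>"
    then have t: "t \<in> {-\<delta><..<\<delta>}" by auto
    have "h t = ip y ((g \<circ> L t) (p w - p v))"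
      using \<alpha>(5)[OF t V(2,1)] by (simp add: h_def pull)
    also have "\<dots> \<le> ip y (g (p w - p v))"
      by (rule max) (rule linear_isometries_comp[OF g \<alpha>(4)[OF t]])
    also have "\<dots> = h 0" using \<alpha>(2) V by (simp add: h_def pull)
    finally show "h t \<le> h 0" .
  qed
  ultimately have "ip (inv g y) (u w - u v) = 0" using \<alpha>(1) by (metis DERIV_local_max)
  then show ?thesis by (simp add: ip_sym)
qed

end

section \<open>Counting degrees of freedom\<close>

text \<open>
  Gaussian elimination: use one unknown to solve an equation in which it occurs, and substitute.
\<close>

lemma underdetermined_system:
  fixes a :: "'i \<Rightarrow> 'k \<Rightarrow> real"
  assumes "finite K" "finite I" "card K < card I"
  shows "\<exists>c. (\<exists>i\<in>I. c i \<noteq> 0) \<and> (\<forall>k\<in>K. (\<Sum>i\<in>I. c i * a i k) = 0)"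
  using assms
proof (induction K arbitrary: I a rule: finite_induct)
  case empty
  then have "I \<noteq> {}" by auto
  then show ?case by (intro exI[of _ "\<lambda>_. 1"]) auto
next
  case (insert k K)
  show ?case
  proof (cases "\<forall>i\<in>I. a i k = 0")
    case True
    obtain c where "\<exists>i\<in>I. c i \<noteq> 0" "\<forall>k\<in>K. (\<Sum>i\<in>I. c i * a i k) = 0"
      using insert.IH[of I a] insert.prems insert.hyps by auto
    moreover have "(\<Sum>i\<in>I. c i * a i k) = 0" using True by simp
    ultimately show ?thesis by (intro exI[of _ c]) auto
  next
    case False
    then obtain i0 where i0: "i0 \<in> I" "a i0 k \<noteq> 0" by blast
    define J where "J = I - {i0}"
    define t where "t i = a i k / a i0 k" for i
    have J: "finite J" "card K < card J" "i0 \<notin> J" "I = insert i0 J"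
      using insert.prems insert.hyps i0 by (auto simp: J_def)
    obtain c where c: "\<exists>i\<in>J. c i \<noteq> 0" "\<forall>l\<in>K. (\<Sum>i\<in>J. c i * (a i l - t i * a i0 l)) = 0"
      using insert.IH[of J "\<lambda>i l. a i l - t i * a i0 l"] J by blast
    \<comment> \<open>the value of the eliminated unknown that solves equation \<open>k\<close>\<close>
    define c' where "c' = c(i0 := - (\<Sum>i\<in>J. c i * t i))"
    have sum: "(\<Sum>i\<in>I. c' i * a i l) = (\<Sum>i\<in>J. c i * (a i l - t i * a i0 l))" for l
    proof -
      have "(\<Sum>i\<in>J. c' i * a i l) = (\<Sum>i\<in>J. c i * a i l)"
        by (rule sum.cong) (use J in \<open>auto simp: c'_def\<close>)
      then show ?thesis
        using J by (simp add: c'_def right_diff_distrib sum_subtractf sum_distrib_right mult.assoc)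
    qed
    have "(\<Sum>i\<in>J. c i * (a i k - t i * a i0 k)) = 0" using i0 by (simp add: t_def)
    then have "\<forall>l\<in>insert k K. (\<Sum>i\<in>I. c' i * a i l) = 0" using c(2) by (simp add: sum)
    moreover have "\<exists>i\<in>I. c' i \<noteq> 0"
      using c(1) J by (auto simp: c'_def)
    ultimately show ?thesis by blast
  qed
qed

context normed_basis
begin

lemma exists_nonzero_solution:
  fixes F :: "(('v \<Rightarrow> 'a) \<Rightarrow> real) set"
  assumes fin: "finite J" "finite F" and card: "card F < card J * card B"
    and add: "\<And>f x y. f \<in> F \<Longrightarrow> f (\<lambda>z. x z + y z) = f x + f y"
    and scale: "\<And>f c x. f \<in> F \<Longrightarrow> f (\<lambda>z. c *\<^sub>R x z) = c * f x"
  shows "\<exists>u. (\<exists>z\<in>J. u z \<noteq> 0) \<and> (\<forall>z. z \<notin> J \<longrightarrow> u z = 0) \<and> (\<forall>f\<in>F. f u = 0)"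
proof -
  define U where "U i z = (if z = fst i then snd i else 0)" for i :: "'v \<times> 'a" and z
  have "finite (J \<times> B)" "card F < card (J \<times> B)"
    using fin card finite_B by (simp_all add: card_cartesian_product)
  then obtain c where c: "\<exists>i\<in>J \<times> B. c i \<noteq> 0" "\<forall>f\<in>F. (\<Sum>i\<in>J \<times> B. c i * f (U i)) = 0"
    using underdetermined_system[OF fin(2), of "J \<times> B" "\<lambda>i f. f (U i)"] by blast
  define u where "u z = (\<Sum>i\<in>J \<times> B. c i *\<^sub>R U i z)" for z
  have lin: "f (\<lambda>z. \<Sum>i\<in>I. c i *\<^sub>R U i z) = (\<Sum>i\<in>I. c i * f (U i))" if "f \<in> F" "finite I" for f I
    using that(2)
  proof induction
    case empty
    show ?case using scale[OF that(1), of 0] by simp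
  next
    case (insert i I)
    then show ?case using add[OF that(1)] scale[OF that(1)] by simp
  qed
  have "f u = 0" if "f \<in> F" for f
    using lin[OF that \<open>finite (J \<times> B)\<close>] c(2) that by (simp add: u_def[abs_def])
  moreover have uJ: "u z = (\<Sum>e\<in>B. c (z, e) *\<^sub>R e)" if "z \<in> J" for z
  proof -
    have "u z = (\<Sum>x\<in>J. \<Sum>e\<in>B. c (x, e) *\<^sub>R U (x, e) z)"
      by (simp add: u_def sum.cartesian_product case_prod_unfold)
    also have "\<dots> = (\<Sum>x\<in>J. if z = x then \<Sum>e\<in>B. c (x, e) *\<^sub>R e else 0)"
      by (rule sum.cong) (auto simp: U_def)
    also have "\<dots> = (\<Sum>e\<in>B. c (z, e) *\<^sub>R e)" using that fin(1) by simp
    finally show ?thesis .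
  qed
  moreover have "u z = 0" if "z \<notin> J" for z
    unfolding u_def by (rule sum.neutral) (use that in \<open>auto simp: U_def\<close>)
  moreover have "\<exists>z\<in>J. u z \<noteq> 0"
  proof -
    obtain z e where ze: "z \<in> J" "e \<in> B" "c (z, e) \<noteq> 0" using c(1) by auto
    then have "(\<Sum>e\<in>B. c (z, e) *\<^sub>R e) \<noteq> 0"
      using independentD[OF independent_B finite_B subset_refl, of "\<lambda>e. c (z, e)"] by blast
    then show ?thesis using uJ ze(1) by auto
  qed
  ultimately show ?thesis by blast
qed

lemma extend_to_basis:
  fixes Q :: "'a set"
  assumes "independent Q"
  shows "\<exists>R. Q \<subseteq> R \<and> finite R \<and> span R = UNIV \<and> card R = card B \<and> card (R - Q) = card B - card Q"
proof -
  obtain R where R: "Q \<subseteq> R" "independent R" "UNIV \<subseteq> span R"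
    using real_vector.maximal_independent_subset_extend[OF subset_UNIV assms] by metis
  have fin: "finite R"
    using real_vector.independent_span_bound[OF finite_B R(2)] span_B by simp
  have "card R = card B"
    using real_vector.independent_span_bound[OF finite_B R(2)]
      real_vector.independent_span_bound[OF fin independent_B] R(3) span_B by (auto simp: top.extremum_unique)
  then show ?thesis
    using R fin card_Diff_subset[OF finite_subset[OF R(1) fin] R(1)] by (intro exI[of _ R]) auto
qed

end

context invariant_inner_product
begin

text \<open>
  These are the linear conditions that a trivial flex satisfies because linear isometries preserve
  the inner product and linear combinations.
  Orthogonality alone would be too weak: if a point lies on the line through two others, moving it
  perpendicularly to that line is orthogonal to all differences of positions, but it breaks the
  affine relation between the three points.
\<close>

definition euclidean_flex :: "'v set \<Rightarrow> ('v \<Rightarrow> 'a) \<Rightarrow> ('v \<Rightarrow> 'a) \<Rightarrow> bool" where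
  "euclidean_flex V p u \<longleftrightarrow>
     (\<forall>a\<in>V. \<forall>b\<in>V. ip (u a - u b) (p a - p b) = 0) \<and>
     (\<forall>v\<in>V. \<forall>z\<in>V. \<forall>S\<subseteq>V. \<forall>c. p z - p v = (\<Sum>s\<in>S. c s *\<^sub>R (p s - p v)) \<longrightarrow>
        u z - u v = (\<Sum>s\<in>S. c s *\<^sub>R (u s - u v)))"

lemma trivial_flex_imp_euclidean_flex: "trivial_flex V p u \<Longrightarrow> euclidean_flex V p u"
  unfolding euclidean_flex_def
  by (blast intro: trivial_flex_orthogonal trivial_flex_preserves_affine_relations)

text \<open>
  Count of the degrees of freedom of a Euclidean motion. Once \<open>v\<close> and \<open>i\<close> further points in
  general position are at rest, a point outside their affine hull has velocity orthogonal to
  \<open>Suc i\<close> independent vectors, so \<open>card B - Suc i\<close> further conditions stop it. A point inside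
  their affine hull is at rest already. Hence a maximal subset in general position is
  completed point by point.

  The conditions are pairs \<open>(z, r)\<close>, standing for \<open>ip (u z) r = 0\<close>. The bound is summed up to the
  number of points even if the points are dependent and fewer conditions suffice. This is harmless
  for at most \<open>card B + 1\<close> points, and it makes the count the same in all cases.
\<close>

lemma euclidean_flex_pinned:
  fixes p :: "'v \<Rightarrow> 'a"
  assumes V: "finite V" "v \<in> V" and S: "S \<subseteq> V - {v}"
    and inj: "inj_on (\<lambda>s. p s - p v) S" and ind: "independent ((\<lambda>s. p s - p v) ` S)"
  shows "\<exists>K. finite K \<and> card K \<le> (\<Sum>i = card S..<card (V - {v}). card B - Suc i) \<and>
    (\<forall>u. euclidean_flex V p u \<and> u v = 0 \<and> (\<forall>s\<in>S. u s = 0) \<and> (\<forall>(z, r)\<in>K. ip (u z) r = 0)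
      \<longrightarrow> (\<forall>z\<in>V. u z = 0))"
  using S inj ind
proof (induction "card (V - {v}) - card S" arbitrary: S rule: less_induct)
  case less
  define q where "q s = p s - p v" for s
  note S = less.prems(1) and inj = less.prems(2)[folded q_def] and ind = less.prems(3)[folded q_def]
  have finS: "finite S" using S V(1) finite_subset by blast
  show ?case
  proof (cases "\<exists>z\<in>V - {v}. q z \<notin> span (q ` S)")
    case True
    then obtain z where z: "z \<in> V - {v}" "q z \<notin> span (q ` S)" by blast
    then have zS: "z \<notin> S" using span_base[of "q z" "q ` S"] by blast
    define T where "T = insert z S"
    have T: "T \<subseteq> V - {v}" "card T = Suc (card S)"
      using z S zS finS by (auto simp: T_def)
    have le: "card T \<le> card (V - {v})" using T(1) V(1) by (intro card_mono) auto
    have injT: "inj_on q T"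
      unfolding T_def inj_on_insert using inj z(2) span_base[of "q z" "q ` S"] by blast
    have indT: "independent (q ` T)"
      using ind z(2) by (simp add: T_def independent_insertI)
    have "card (V - {v}) - card T < card (V - {v}) - card S" using le T(2) by simp
    from less.hyps[OF this T(1) injT[unfolded q_def] indT[unfolded q_def]]
    obtain K where K: "finite K" "card K \<le> (\<Sum>i = card T..<card (V - {v}). card B - Suc i)"
      "\<And>u. euclidean_flex V p u \<Longrightarrow> u v = 0 \<Longrightarrow> \<forall>s\<in>T. u s = 0 \<Longrightarrow> \<forall>(z, r)\<in>K. ip (u z) r = 0
        \<Longrightarrow> \<forall>z\<in>V. u z = 0"
      by blast
    obtain R where R: "q ` T \<subseteq> R" "finite R" "span R = UNIV"
        "card (R - q ` T) = card B - card (q ` T)"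
      using extend_to_basis[OF indT] by blast
    define K' where "K' = K \<union> {z} \<times> (R - q ` T)"
    have "card K' \<le> card K + card (R - q ` T)"
      unfolding K'_def using card_Un_le[of K "{z} \<times> (R - q ` T)"] by (simp add: card_cartesian_product)
    also have "\<dots> \<le> (\<Sum>i = card T..<card (V - {v}). card B - Suc i) + (card B - Suc (card S))"
      using K(2) R(4) T(2) by (simp add: card_image[OF injT])
    also have "\<dots> = (\<Sum>i = card S..<card (V - {v}). card B - Suc i)"
      using le T(2) by (simp add: sum.atLeast_Suc_lessThan)
    finally have "card K' \<le> (\<Sum>i = card S..<card (V - {v}). card B - Suc i)" .
    moreover have "finite K'" using K(1) R(2) by (simp add: K'_def)
    moreover have "\<forall>x\<in>V. u x = 0"
      if u: "euclidean_flex V p u" "u v = 0" "\<forall>s\<in>S. u s = 0" "\<forall>(z, r)\<in>K'. ip (u z) r = 0" for u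
    proof -
      have perp: "ip (u z) (p z - p s) = 0" if "s \<in> insert v S" for s
      proof -
        have "s \<in> V" "u s = 0" using that u(2,3) S V(2) by auto
        then have "ip (u z - u s) (p z - p s) = 0"
          using u(1) z(1) unfolding euclidean_flex_def by blast
        then show ?thesis using \<open>u s = 0\<close> by simp
      qed
      have "ip (u z) (q s) = 0" if "s \<in> T" for s
      proof (cases "s = z")
        case True
        then show ?thesis using perp[of v] by (simp add: q_def)
      next
        case False
        then have "s \<in> S" using that by (simp add: T_def)
        have "q s = (p z - p v) - (p z - p s)" by (simp add: q_def)
        then show ?thesis
          using perp[of v] perp[of s] \<open>s \<in> S\<close> by (simp add: ip.diff_right)
      qed
      moreover have "ip (u z) r = 0" if "r \<in> R - q ` T" for r
        using u(4) that by (auto simp: K'_def)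
      ultimately have "u z = 0" using R(3) by (intro orthogonal_to_spanning_set[of R]) auto
      then have "\<forall>s\<in>T. u s = 0" using u(3) by (simp add: T_def)
      moreover have "\<forall>(z, r)\<in>K. ip (u z) r = 0" using u(4) by (auto simp: K'_def)
      ultimately show ?thesis using K(3) u(1,2) by blast
    qed
    ultimately show ?thesis by blast
  next
    case False
    have "\<forall>z\<in>V. u z = 0" if u: "euclidean_flex V p u" "u v = 0" "\<forall>s\<in>S. u s = 0" for u
    proof
      fix z assume "z \<in> V"
      show "u z = 0"
      proof (cases "z = v")
        case True
        then show ?thesis using u by simp
      next
        case zv: False
        then have "q z \<in> span (q ` S)" using False \<open>z \<in> V\<close> by blast
        then obtain d where "q z = (\<Sum>y\<in>q ` S. d y *\<^sub>R y)"
          using real_vector.span_finite[of "q ` S"] finS by auto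
        also have "\<dots> = (\<Sum>s\<in>S. d (q s) *\<^sub>R q s)" by (simp add: sum.reindex[OF inj])
        finally have "p z - p v = (\<Sum>s\<in>S. d (q s) *\<^sub>R (p s - p v))" by (simp add: q_def)
        moreover have "S \<subseteq> V" using S by blast
        ultimately have "u z - u v = (\<Sum>s\<in>S. d (q s) *\<^sub>R (u s - u v))"
          using u(1) \<open>z \<in> V\<close> V(2) unfolding euclidean_flex_def
          by (elim conjE ballE[where x = v] ballE[where x = z] allE[where x = S]
              allE[where x = "\<lambda>s. d (q s)"] impE) auto
        also have "\<dots> = 0" using u(2,3) by simp
        finally show ?thesis using u(2) by simp
      qed
    qed
    then show ?thesis by (intro exI[of _ "{}"]) auto
  qed
qed

end

text \<open>
  With one vertex at rest, the largest possible number of edges on \<open>Suc N\<close> vertices and the number of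
  conditions that pin a Euclidean motion add up exactly to the number \<open>N * d\<close> of unknowns. This fails
  for \<open>N > d\<close>.
\<close>

lemma rigidity_dimension_count:
  assumes "N \<le> d"
  shows "(Suc N choose 2) + (\<Sum>i = 0..<N. d - Suc i) = N * d"
  using assms
proof (induction N)
  case (Suc N)
  have "Suc (Suc N) choose 2 = (Suc N choose 2) + Suc N"
    by (simp add: numeral_2_eq_2)
  then show ?case using Suc by simp
qed simp

lemma rigidity_operator_linear:
  assumes wp: "well_positioned V E p" and e: "e \<in> E"
  shows "rigidity_operator E p (\<lambda>z. x z + y z) e = rigidity_operator E p x e + rigidity_operator E p y e"
    and "rigidity_operator E p (\<lambda>z. c *\<^sub>R x z) e = c * rigidity_operator E p x e"
proof -
  have "card e = 2"
    using wp e by (auto simp: well_positioned_def framework_def simple_graph_def)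
  then obtain a b where ab: "e = {a, b}" by (auto simp: card_2_iff)
  note edge = rigidity_operator_edge[OF wp e[unfolded ab]]
  show "rigidity_operator E p (\<lambda>z. x z + y z) e = rigidity_operator E p x e + rigidity_operator E p y e"
    unfolding ab edge by (simp add: blinfun.add_right blinfun.diff_right)
  show "rigidity_operator E p (\<lambda>z. c *\<^sub>R x z) e = c * rigidity_operator E p x e"
    unfolding ab edge by (simp add: blinfun.scaleR_right blinfun.diff_right right_diff_distrib)
qed

context invariant_inner_product
begin

text \<open>
  Infinitesimal flexes satisfy \<open>ip (u w - u v) q = 0\<close> with \<open>q = p w - p v\<close>. The claim is that they
  satisfy no further condition of this kind. Otherwise, with \<open>v\<close> at rest, the velocity of \<open>w\<close> would
  be orthogonal to the two independent vectors \<open>q\<close> and \<open>y\<close>, so \<open>card B - 2\<close> conditions would stop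
  \<open>w\<close>, one fewer than \<open>euclidean_flex_pinned\<close> allows for. Then the edge conditions and the pinning
  conditions together would be fewer than the unknowns and would still admit only the zero solution.
\<close>

lemma relative_velocities_fill_hyperplane:
  fixes p :: "'v \<Rightarrow> 'a"
  assumes wp: "well_positioned V E p" and V: "finite V" "card V \<le> card B + 1"
    and rigid: "\<And>u. infinitesimal_flex E p u \<Longrightarrow> euclidean_flex V p u"
    and vw: "v \<in> V" "w \<in> V" "p w \<noteq> p v"
    and y: "\<And>u. infinitesimal_flex E p u \<Longrightarrow> ip (u w - u v) y = 0"
  shows "y \<in> span {p w - p v}"
proof (rule ccontr)
  define q where "q = p w - p v"
  define N where "N = card (V - {v})"
  have cardV: "card V = Suc N" using card_Suc_Diff1[OF V(1) vw(1)] by (simp only: N_def)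
  then have N: "N \<le> card B" using V(2) by simp
  have "w \<in> V - {v}" using vw by auto
  then have "N \<ge> 1" unfolding N_def using V(1) by (metis One_nat_def Suc_leI card_gt_0_iff empty_iff finite_Diff)
  assume "y \<notin> span {p w - p v}"
  then have y_notin: "y \<notin> span {q}" by (simp add: q_def)
  have "q \<noteq> 0" using vw(3) by (simp add: q_def)
  then have "independent {q}" by simp
  with y_notin have ind: "independent {y, q}" by (simp add: independent_insertI)
  obtain R where R: "{y, q} \<subseteq> R" "finite R" "span R = UNIV" "card R = card B"
      "card (R - {y, q}) = card B - card {y, q}"
    using extend_to_basis[OF ind] by metis
  have "y \<noteq> q" using y_notin span_base[of q "{q}"] by blast
  then have card_yq: "card {y, q} = 2" by simp
  then have B2: "card B \<ge> 2" using card_mono[OF R(2,1)] R(4) by simp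
  have "inj_on (\<lambda>s. p s - p v) {w}" "independent ((\<lambda>s. p s - p v) ` {w})" "{w} \<subseteq> V - {v}"
    using \<open>independent {q}\<close> \<open>w \<in> V - {v}\<close> by (simp_all add: q_def)
  from euclidean_flex_pinned[OF V(1) vw(1) this(3,1,2)]
  obtain K where K: "finite K" "card K \<le> (\<Sum>i = 1..<N. card B - Suc i)"
    "\<And>u. euclidean_flex V p u \<Longrightarrow> u v = 0 \<Longrightarrow> u w = 0 \<Longrightarrow> \<forall>(z, r)\<in>K. ip (u z) r = 0
      \<Longrightarrow> \<forall>z\<in>V. u z = 0"
    unfolding N_def by auto
  define F where "F = (\<lambda>e u. rigidity_operator E p u e) ` E
      \<union> (\<lambda>(z, r) u. ip (u z) r) ` ({w} \<times> (R - {y, q}) \<union> K)"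
  have sub: "E \<subseteq> {e. e \<subseteq> V \<and> card e = 2}"
    using wp by (simp add: well_positioned_def framework_def simple_graph_def)
  have fin: "finite {e. e \<subseteq> V \<and> card e = 2}" using V(1) by simp
  have E: "finite E" "card E \<le> Suc N choose 2"
    using finite_subset[OF sub fin] card_mono[OF fin sub] by (simp_all only: n_subsets[OF V(1)] cardV)
  have "finite F" using E(1) R(2) K(1) by (simp add: F_def)
  have "card F \<le> card E + card ({w} \<times> (R - {y, q}) \<union> K)"
    unfolding F_def using E(1) R(2) K(1)
    by (intro order_trans[OF card_Un_le] add_mono card_image_le) auto
  also have "\<dots> \<le> card E + (card (R - {y, q}) + card K)"
    using card_Un_le[of "{w} \<times> (R - {y, q})" K] by (simp add: card_cartesian_product)
  also have "\<dots> \<le> (Suc N choose 2) + (card B - 2 + (\<Sum>i = 1..<N. card B - Suc i))"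
    using E(2) K(2) R(5) card_yq by simp
  also have "\<dots> < (Suc N choose 2) + (\<Sum>i = 0..<N. card B - Suc i)"
    using \<open>N \<ge> 1\<close> B2 by (simp add: sum.atLeast_Suc_lessThan)
  also have "\<dots> = N * card B" by (rule rigidity_dimension_count[OF N])
  finally have cardF: "card F < card (V - {v}) * card B" by (simp add: N_def)
  have "\<exists>u. (\<exists>z\<in>V - {v}. u z \<noteq> 0) \<and> (\<forall>z. z \<notin> V - {v} \<longrightarrow> u z = 0) \<and> (\<forall>f\<in>F. f u = 0)"
  proof (rule exists_nonzero_solution[OF _ \<open>finite F\<close> cardF])
    show "finite (V - {v})" using V(1) by simp
    show "f (\<lambda>z. x z + y z) = f x + f y" if "f \<in> F" for f x y
      using that unfolding F_def by (auto simp: rigidity_operator_linear[OF wp] ip.add_left)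
    show "f (\<lambda>z. c *\<^sub>R x z) = c * f x" if "f \<in> F" for f c x
      using that unfolding F_def by (auto simp: rigidity_operator_linear[OF wp] ip.scaleR_left)
  qed
  then obtain u where u: "\<exists>z\<in>V - {v}. u z \<noteq> 0" "\<And>z. z \<notin> V - {v} \<Longrightarrow> u z = 0"
      "\<And>f. f \<in> F \<Longrightarrow> f u = 0"
    by blast
  have "rigidity_operator E p u e = 0" if "e \<in> E" for e
    using u(3)[of "\<lambda>u. rigidity_operator E p u e"] that by (auto simp: F_def)
  then have flex: "infinitesimal_flex E p u"
    unfolding infinitesimal_flex_def
    by (intro ext) (auto simp: rigidity_operator_def)
  have eucl: "euclidean_flex V p u" by (rule rigid[OF flex])
  have "u v = 0" using u(2) by simp
  have extra: "ip (u z) r = 0" if "(z, r) \<in> {w} \<times> (R - {y, q}) \<union> K" for z r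
    using u(3)[of "\<lambda>u. ip (u z) r"] that by (force simp: F_def)
  have "ip (u w - u v) (p w - p v) = 0" using eucl vw unfolding euclidean_flex_def by blast
  then have "ip (u w) q = 0" by (simp add: q_def \<open>u v = 0\<close>)
  moreover have "ip (u w) y = 0" using y[OF flex] by (simp add: \<open>u v = 0\<close>)
  ultimately have "ip (u w) r = 0" if "r \<in> R" for r
    using extra[of w r] that by auto
  then have "u w = 0" using R(3) by (rule orthogonal_to_spanning_set)
  then have "\<forall>z\<in>V. u z = 0"
    using K(3)[OF eucl \<open>u v = 0\<close>] extra by blast
  then show False using u(1) by blast
qed

text \<open>
  For a given \<open>y\<close>, choose a linear isometry \<open>g\<close> that maximises \<open>ip y (g q)\<close>. Then \<open>inv g y\<close> is
  orthogonal to all relative velocities, hence a multiple \<open>c *\<^sub>R q\<close> of \<open>q\<close>. As \<open>g\<close> preserves both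
  norms, \<open>norm y\<close> has the same ratio to \<open>sqrt (ip y y)\<close> as \<open>norm q\<close> to \<open>sqrt (ip q q)\<close>. So the two
  norms are proportional.
\<close>

lemma euclidean_norm_if_relative_velocities_fill:
  assumes q: "p w \<noteq> p v" and vw: "v \<in> V" "w \<in> V"
    and rigid: "\<And>u. infinitesimal_flex E p u \<Longrightarrow> trivial_flex V p u"
    and fill: "\<And>y. (\<And>u. infinitesimal_flex E p u \<Longrightarrow> ip (u w - u v) y = 0) \<Longrightarrow> y \<in> span {p w - p v}"
  shows "euclidean_norm (norm :: 'a \<Rightarrow> real)"
proof -
  define q where "q = p w - p v"
  have "q \<noteq> 0" using q by (simp add: q_def)
  then have qq: "ip q q > 0" by (rule ip_pos)
  define k where "k = (norm q)\<^sup>2 / ip q q"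
  have "k > 0" using \<open>q \<noteq> 0\<close> qq by (simp add: k_def)
  have "norm y = sqrt (k * ip y y)" for y
  proof -
    have "continuous_on linear_isometries (\<lambda>L. ip y (L q))"
      by (intro continuous_on_compose2[OF linear_continuous_on[OF ip.bounded_linear_right]]
          continuous_on_evaluation) auto
    moreover have "linear_isometries \<noteq> ({} :: ('a \<Rightarrow> 'a) set)"
      by (auto simp: linear_isometries_def linear_iff intro!: exI[of _ "\<lambda>x. x"])
    ultimately obtain g where g: "g \<in> linear_isometries"
        "\<And>L. L \<in> linear_isometries \<Longrightarrow> ip y (L q) \<le> ip y (g q)"
      using continuous_attains_sup[OF compact_linear_isometries, of "\<lambda>L. ip y (L q)"] by metis
    have "inv g y \<in> span {p w - p v}"
    proof (rule fill)
      fix u assume "infinitesimal_flex E p u"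
      then have "trivial_flex V p u" by (rule rigid)
      then show "ip (u w - u v) (inv g y) = 0"
        using trivial_flex_critical[OF _ vw g(1)] g(2) unfolding q_def by blast
    qed
    then obtain c where c: "inv g y = c *\<^sub>R q"
      by (auto simp: q_def span_singleton)
    have "norm y = norm (inv g y)"
      using linear_isometry_inv(1)[OF g(1)] by (simp add: linear_isometries_def)
    moreover have "ip y y = ip (inv g y) (inv g y)"
      using invariant[OF linear_isometry_inv(1)[OF g(1)]] by simp
    ultimately have "norm y = \<bar>c\<bar> * norm q" "ip y y = c\<^sup>2 * ip q q"
      by (simp_all add: c ip.scaleR_left ip.scaleR_right power2_eq_square)
    then show ?thesis
      using qq by (simp add: k_def real_sqrt_mult mult.commute)
  qed
  moreover have "inner_product (\<lambda>x y. k * ip x y)"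
    using \<open>k > 0\<close> unfolding inner_product_def bilinear_def linear_iff
    by (simp add: ip.add_left ip.add_right ip.scaleR_left ip.scaleR_right ip_pos ip_sym algebra_simps)
  ultimately show ?thesis unfolding euclidean_norm_def by blast
qed

end

section \<open>Small frameworks\<close>

theorem theorem5p8:
  fixes V :: "'v set" and E :: "'v set set" and p :: "'v \<Rightarrow> 'a::real_normed_vector"
  assumes finite_dimensional: "\<exists>B :: 'a set. finite B \<and> span B = UNIV"
    and non_euclidean: "\<not> euclidean_norm (norm :: 'a \<Rightarrow> real)"
    and small: "small_framework V E p"
    and well_positioned: "well_positioned V E p"
  shows "infinitesimally_flexible V E p \<or> card V = 1"
proof (rule ccontr)
  assume neg: "\<not> (infinitesimally_flexible V E p \<or> card V = 1)"
  then have triv: "trivial_flex V p u" if "infinitesimal_flex E p u" for u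
    using that well_positioned
    by (simp add: infinitesimally_flexible_def infinitesimally_rigid_def)
  have V: "finite V" "card V \<le> dim (UNIV :: 'a set) + 1" "V \<noteq> {}"
    using small by (auto simp: small_framework_def framework_def)
  obtain v where "v \<in> V" using V(3) by blast
  have "V \<noteq> {v}" using neg by auto
  then obtain w where "w \<in> V" "w \<noteq> v" using \<open>v \<in> V\<close> by blast
  obtain B0 :: "'a set" where B0: "finite B0" "span B0 = UNIV" using finite_dimensional by blast
  obtain B :: "'a set" where B: "B \<subseteq> B0" "independent B" "B0 \<subseteq> span B"
    using real_vector.maximal_independent_subset_extend[OF empty_subsetI, of B0]
      real_vector.independent_empty by metis
  have "span B = UNIV" using B(3) B0(2) by (metis span_minimal subspace_span top.extremum_unique)
  then interpret normed_basis B
    using B B0(1) by unfold_locales (auto intro: finite_subset)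
  obtain ip M where ip: "inner_product ip" "\<And>x y. \<bar>ip x y\<bar> \<le> M * norm x * norm y"
      "\<And>g x y. g \<in> linear_isometries \<Longrightarrow> ip (g x) (g y) = ip x (y :: 'a)"
    using exists_invariant_inner_product by blast
  interpret invariant_inner_product B ip M
    by unfold_locales (use ip in auto)
  show False
  proof (cases "\<exists>a\<in>V. \<exists>b\<in>V. p b \<noteq> p a")
    case True
    then obtain a b where ab: "a \<in> V" "b \<in> V" "p b \<noteq> p a" by blast
    have "card V \<le> card B + 1" using V(2) by (simp add: dim_UNIV)
    then have fill: "y \<in> span {p b - p a}"
      if "\<And>u. infinitesimal_flex E p u \<Longrightarrow> ip (u b - u a) y = 0" for y
      by (intro relative_velocities_fill_hyperplane[OF well_positioned V(1)]
          trivial_flex_imp_euclidean_flex triv that ab)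
    then have "euclidean_norm (norm :: 'a \<Rightarrow> real)"
      using euclidean_norm_if_relative_velocities_fill[where V = V and E = E, OF ab(3,1,2) triv]
      by blast
    then show False using non_euclidean by blast
  next
    case False
    \<comment> \<open>if all points coincide there are no edges, so a single vertex may move on its own;
      but a trivial flex moves coinciding points alike\<close>
    have "E = {}"
    proof (rule ccontr)
      assume "E \<noteq> {}"
      then obtain e where e: "e \<in> E" by blast
      then have "e \<subseteq> V" "card e = 2"
        using well_positioned by (auto simp: well_positioned_def framework_def simple_graph_def)
      then obtain a b where ab: "e = {a, b}" "a \<in> V" "b \<in> V" by (auto simp: card_2_iff)
      then have "smooth_point (p a - p b)" using well_positioned e by (auto simp: well_positioned_def)
      moreover have "p a = p b" using False ab(2,3) by blast
      ultimately show False by (simp add: smooth_point_def)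
    qed
    have "\<exists>x :: 'a. x \<noteq> 0"
    proof (rule ccontr)
      assume "\<nexists>x :: 'a. x \<noteq> 0"
      then have zero: "x = 0" for x :: 'a by blast
      have "norm x = sqrt (ip x x)" for x :: 'a
        using zero[of x] by (simp add: ip.zero_left)
      then show False using non_euclidean ip(1) unfolding euclidean_norm_def by blast
    qed
    then obtain x :: 'a where "x \<noteq> 0" by blast
    define u where "u = (\<lambda>_. 0)(w := x)"
    have "infinitesimal_flex E p u"
      by (simp add: infinitesimal_flex_def rigidity_operator_def \<open>E = {}\<close> restrict_def)
    then have "trivial_flex V p u" by (rule triv)
    then have "u w - u v = (\<Sum>s\<in>{}. 0 *\<^sub>R (u s - u v))"
    proof (rule trivial_flex_preserves_affine_relations)
      have "p w = p v" using False \<open>v \<in> V\<close> \<open>w \<in> V\<close> by blast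
      then show "p w - p v = (\<Sum>s\<in>{}. 0 *\<^sub>R (p s - p v))" by simp
    qed (simp_all add: \<open>v \<in> V\<close> \<open>w \<in> V\<close>)
    then show False using \<open>x \<noteq> 0\<close> \<open>w \<noteq> v\<close> by (simp add: u_def)
  qed
qed

end
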